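(* Let $\nu\in\mathbb{R}$ and $\beta>0$. Suppose that $g,\gamma\in\mathcal{S}_0(\mathbb{R})$, where $\gamma$ is the dual window of $g$. If $\mathcal{G}(g,\Lambda_{1,\beta})$ is a Gabor frame for $L^2(\mathbb{R})$, then $\mathcal{G}_\nu(g,Z_\beta)$ is a Gabor frame for $L^2_\nu(0,1)$.
   Context: $L^2_\nu(0,1)$ is the Hilbert space of measurable $f:\mathbb{R}\to\mathbb{C}$ with $f(t+k)=e^{2\pi ik\nu}f(t)$ for all $k\in\mathbb{Z}$ and $\int_0^1|f|^2<\infty$, with the inner product of $L^2(0,1)$. $M_\xi f(t)=e^{2\pi i\xi t}f(t)$, $T_xf(t)=f(t-x)$, $V_gf(x,\xi)=\int_{\mathbb{R}}f(t)\overline{g(t-x)}e^{-2\pi i\xi t}dt$, $h_0(t)=2^{1/4}e^{-\pi t^2}$, and $\mathcal{S}_0(\mathbb{R})=\{g\in L^2(\mathbb{R}):V_{h_0}g\in L^1(\mathbb{R}^2)\}$ (Feichtinger's algebra). Windows $g$ are normalized by $\|g\|_{L^2(\mathbb{R})}=1$. $\Sigma_\nu f(t)=\sum_{k\in\mathbb{Z}}e^{2\pi ik\nu}f(t-k)$. $\Lambda_{1,\beta}=\mathbb{Z}\times\beta\mathbb{Z}$ and $\mathcal{G}(g,\Lambda_{1,\beta})=\{M_{\beta n}T_kg:k,n\in\mathbb{Z}\}$, which is a Gabor frame for $L^2(\mathbb{R})$ if it is a frame of that Hilbert space. The dual window is $\gamma=S^{-1}g$, where $Sf=\sum_{k,n\in\mathbb{Z}}\langle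 f,M_{\beta n}T_kg\rangle_{L^2(\mathbb{R})}M_{\beta n}T_kg$ is the frame operator. $Z_\beta=\{(0,\beta n):n\in\mathbb{Z}\}$; $\mathcal{G}_\nu(g,Z_\beta)=\{\Sigma_\nu(M_{\beta n}g):n\in\mathbb{Z}\}$ is a Gabor frame for $L^2_\nu(0,1)$ if there are $A,B>0$ with $A\|f\|^2\le\sum_{n}|\langle f,\Sigma_\nu(M_{\beta n}g)\rangle_{L^2_\nu(0,1)}|^2\le B\|f\|^2$ for all $f\in L^2_\nu(0,1)$. *)

theory Defs
  imports "HOL-Analysis.Analysis"
begin

(* Elements of the L2 spaces below are represented by functions, not by classes modulo equality
   almost everywhere; norms and inner products see the functions only up to null sets. *)

definition L2 :: "(real \<Rightarrow> complex) set" where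
  "L2 = {f \<in> borel_measurable lebesgue. integrable lebesgue (\<lambda>t. (cmod (f t))\<^sup>2)}"

definition L2_inner :: "(real \<Rightarrow> complex) \<Rightarrow> (real \<Rightarrow> complex) \<Rightarrow> complex" where
  "L2_inner f h = (\<integral>t. f t * cnj (h t) \<partial>lebesgue)"

definition L2_norm :: "(real \<Rightarrow> complex) \<Rightarrow> real" where
  "L2_norm f = sqrt (Re (L2_inner f f))"

definition L2_quasi :: "real \<Rightarrow> (real \<Rightarrow> complex) set" where
  "L2_quasi \<nu> = {f \<in> borel_measurable lebesgue.
     (\<forall>t. \<forall>k::int. f (t + of_int k) = cis (2 * pi * of_int k * \<nu>) * f t) \<and>
     set_integrable lebesgue {0<..<1} (\<lambda>t. (cmod (f t))\<^sup>2)}"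

definition L2_unit_inner :: "(real \<Rightarrow> complex) \<Rightarrow> (real \<Rightarrow> complex) \<Rightarrow> complex" where
  "L2_unit_inner f h = (LINT t:{0<..<1}|lebesgue. f t * cnj (h t))"

definition modulation :: "real \<Rightarrow> (real \<Rightarrow> complex) \<Rightarrow> real \<Rightarrow> complex" where
  "modulation \<xi> f t = cis (2 * pi * \<xi> * t) * f t"

definition translation :: "real \<Rightarrow> (real \<Rightarrow> complex) \<Rightarrow> real \<Rightarrow> complex" where
  "translation x f t = f (t - x)"

definition stft :: "(real \<Rightarrow> complex) \<Rightarrow> (real \<Rightarrow> complex) \<Rightarrow> real \<Rightarrow> real \<Rightarrow> complex" where
  "stft g f x \<xi> = (\<integral>t. f t * cnj (g (t - x)) * cis (- (2 * pi * \<xi> * t)) \<partial>lebesgue)"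

definition h0 :: "real \<Rightarrow> complex" where
  "h0 t = of_real (2 powr (1/4) * exp (- (pi * t\<^sup>2)))"

definition feichtinger_algebra :: "(real \<Rightarrow> complex) set" where
  "feichtinger_algebra =
     {g \<in> L2. integrable lebesgue (\<lambda>(x::real, \<xi>::real). stft h0 g x \<xi>)}"

(* Where the series is not absolutely convergent, the value is 0; for f in Feichtinger's algebra
   this happens only on a null set, which is invariant under integer translations. *)
definition quasi_periodization :: "real \<Rightarrow> (real \<Rightarrow> complex) \<Rightarrow> real \<Rightarrow> complex" where
  "quasi_periodization \<nu> f t =
     (\<Sum>\<^sub>\<infinity>k::int. cis (2 * pi * of_int k * \<nu>) * f (t - of_int k))"

(* The vectors are required to lie in H, so that no inner product in the sum is merely the
   default value of a divergent integral. *)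
definition is_frame ::
  "'a set \<Rightarrow> ('a \<Rightarrow> 'a \<Rightarrow> complex) \<Rightarrow> ('i \<Rightarrow> 'a) \<Rightarrow> bool" where
  "is_frame H ip \<phi> \<longleftrightarrow>
     (\<forall>i. \<phi> i \<in> H) \<and>
     (\<exists>A B. 0 < A \<and> 0 < B \<and>
       (\<forall>f\<in>H. (\<lambda>i. (cmod (ip f (\<phi> i)))\<^sup>2) summable_on UNIV \<and>
          A * Re (ip f f) \<le> (\<Sum>\<^sub>\<infinity>i. (cmod (ip f (\<phi> i)))\<^sup>2) \<and>
          (\<Sum>\<^sub>\<infinity>i. (cmod (ip f (\<phi> i)))\<^sup>2) \<le> B * Re (ip f f)))"

definition gabor_system :: "real \<Rightarrow> (real \<Rightarrow> complex) \<Rightarrow> int \<times> int \<Rightarrow> real \<Rightarrow> complex" where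
  "gabor_system \<beta> g = (\<lambda>(k, n). modulation (\<beta> * of_int n) (translation (of_int k) g))"

definition gabor_frame :: "real \<Rightarrow> (real \<Rightarrow> complex) \<Rightarrow> bool" where
  "gabor_frame \<beta> g \<longleftrightarrow> is_frame L2 L2_inner (gabor_system \<beta> g)"

(* The frame operator as a relation: S f = h, the series converging unconditionally in L2. *)
definition frame_operator_rel ::
  "real \<Rightarrow> (real \<Rightarrow> complex) \<Rightarrow> (real \<Rightarrow> complex) \<Rightarrow> (real \<Rightarrow> complex) \<Rightarrow> bool" where
  "frame_operator_rel \<beta> g f h \<longleftrightarrow> f \<in> L2 \<and> h \<in> L2 \<and>
     ((\<lambda>F. L2_norm (\<lambda>t. (\<Sum>i\<in>F. L2_inner f (gabor_system \<beta> g i) * gabor_system \<beta> g i t) - h t))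
        \<longlongrightarrow> 0) (finite_subsets_at_top UNIV)"

(* \<gamma> = S^(-1) g, i.e. S \<gamma> = g. If the Gabor system is a frame, S is a bijection of L2, so this
   determines \<gamma> up to a null set. *)
definition is_dual_window :: "real \<Rightarrow> (real \<Rightarrow> complex) \<Rightarrow> (real \<Rightarrow> complex) \<Rightarrow> bool" where
  "is_dual_window \<beta> g \<gamma> \<longleftrightarrow> frame_operator_rel \<beta> g \<gamma> g"

definition quasi_gabor_system ::
  "real \<Rightarrow> real \<Rightarrow> (real \<Rightarrow> complex) \<Rightarrow> int \<Rightarrow> real \<Rightarrow> complex" where
  "quasi_gabor_system \<nu> \<beta> g n = quasi_periodization \<nu> (modulation (\<beta> * of_int n) g)"

definition quasi_gabor_frame :: "real \<Rightarrow> real \<Rightarrow> (real \<Rightarrow> complex) \<Rightarrow> bool" where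
  "quasi_gabor_frame \<nu> \<beta> g \<longleftrightarrow>
     is_frame (L2_quasi \<nu>) L2_unit_inner (quasi_gabor_system \<nu> \<beta> g)"

end

theory Submission
  imports Defs "HOL-Probability.Characteristic_Functions"
begin

text \<open>The lower frame inequality is carried over from the line to the circle by truncation. A function
\<open>f\<close> in \<open>L2_quasi \<nu>\<close> need not be square integrable on the line, but its restriction to \<open>[0, R)\<close> is,
with energy \<open>R\<close> times that of \<open>f\<close> on the unit interval. Because \<open>f\<close> is quasi-periodic, its coefficient
\<open>\<integral> f (t) cnj (M\<^sub>\<beta>\<^sub>n T\<^sub>k g (t)) dt\<close> on the line is, up to a factor of modulus one depending on \<open>k\<close> and \<open>n\<close>,
the coefficient \<open>c\<^sub>n\<close> with \<open>k = 0\<close>. Unfolding the periodization shows that \<open>c\<^sub>n\<close> is exactly the inner product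
of \<open>f\<close> with \<open>\<Sigma>\<^sub>\<nu> (M\<^sub>\<beta>\<^sub>n g)\<close> (lemma \<open>quasi_inner_eq_line_integral\<close>). If the truncated function had exactly the
coefficients \<open>c\<^sub>n\<close> for \<open>0 \<le> k < R\<close> and \<open>0\<close> for the other \<open>k\<close>, the frame inequality on the line would
read \<open>A R \<parallel>f\<parallel>\<^sup>2 \<le> R \<Sum>|c\<^sub>n|\<^sup>2\<close>, which is the claim. The defect comes from the tails of the
window that cross the ends of \<open>[0, R)\<close>. It is \<open>o(R)\<close>, so that it disappears after division by \<open>R\<close>
(lemmas \<open>truncated_frame_inequality\<close> and \<open>quasi_lower_bound\<close>); bounding the square of a sum of two terms
by twice the sum of the squares costs a factor \<open>2\<close> in the frame constant.

Both the estimate of the defect and the upper frame inequality rest on a Bessel inequality,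
\<open>\<Sum>|\<integral> h cnj (M\<^sub>\<beta>\<^sub>n G)|\<^sup>2 \<le> (C / \<beta>) \<integral> |h|\<^sup>2 |G|\<close>, valid as soon as \<open>\<Sum>\<^sub>k |G (t - k / \<beta>)| \<le> C\<close> for all \<open>t\<close>
(lemma \<open>wiener_bessel\<close>). It is weighted by \<open>|G|\<close>, so it applies to quasi-periodic \<open>h\<close> as well.

That a window in Feichtinger's algebra has such bounded lattice sums is the inclusion of this algebra in the Wiener
amalgam space of locally bounded, globally summable functions. For almost every \<open>x\<close> the
Fourier transform of \<open>t \<mapsto> g (t) h0 (t - x)\<close> is integrable, with some norm \<open>F (x)\<close>. Hence \<open>|g (t)| h0 (t - x) \<le> F (x)\<close>
almost everywhere, where \<open>F\<close> is integrable; averaging over \<open>x\<close> in a lattice cell next to \<open>t - a k\<close> and summing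
over \<open>k\<close> bounds the lattice sum by a multiple of \<open>\<integral> F\<close> (lemma \<open>feichtinger_wiener_representative\<close>).\<close>

section \<open>Borel representatives and translations\<close>

lemma borel_measurable_cis [measurable]: "cis \<in> borel_measurable borel"
  by (intro borel_measurable_continuous_onI continuous_intros)

lemma borel_measurable_cnj [measurable]: "cnj \<in> borel_measurable borel"
  by (intro borel_measurable_continuous_onI continuous_intros)

text \<open>The Fubini theorem and the translation invariance below are used for Borel functions and \<open>lborel\<close>, while the function
spaces consist of Lebesgue measurable functions; this lemma and \<open>lebesgue_integral_eq_lborel\<close> pass between the two.\<close>

lemma borel_representative:
  fixes f :: "real \<Rightarrow> complex"
  assumes "f \<in> borel_measurable lebesgue"
  obtains f' where "f' \<in> borel_measurable borel" "AE t in lborel. f t = f' t"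
proof -
  have "(\<lambda>t. Re (f t)) \<in> borel_measurable lebesgue" "(\<lambda>t. Im (f t)) \<in> borel_measurable lebesgue"
    using assms by (auto simp: measurable_compose)
  from this[THEN completion_ex_borel_measurable_real]
  obtain p q where p: "p \<in> borel_measurable lborel" "AE t in lborel. Re (f t) = p t"
    and q: "q \<in> borel_measurable lborel" "AE t in lborel. Im (f t) = q t"
    by auto
  show ?thesis
  proof
    have "p \<in> borel_measurable borel" "q \<in> borel_measurable borel"
      using p(1) q(1) by auto
    then show "(\<lambda>t. Complex (p t) (q t)) \<in> borel_measurable borel"
      unfolding Complex_eq by measurable
    show "AE t in lborel. f t = Complex (p t) (q t)"
      using p(2) q(2) by eventually_elim (simp add: complex_eq_iff)
  qed
qed

lemma AE_lborel_shift:
  fixes c :: real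
  assumes "AE t in lborel. P t"
  shows "AE t in lborel. P (t + c)"
proof -
  obtain N where N: "N \<in> null_sets lborel" "{t. \<not> P t} \<subseteq> N"
    using assms by (auto simp: eventually_ae_filter)
  have "AE t in lborel. t \<notin> N"
    using N(1) by (rule AE_not_in)
  moreover have "Measurable.pred borel (\<lambda>t. t \<notin> N)"
    using N(1) by (auto simp: null_sets_def pred_def)
  ultimately have "AE t in lborel. c + 1 * t \<notin> N"
    by (intro AE_borel_affine) auto
  then show ?thesis
    by eventually_elim (use N(2) in \<open>auto simp: add.commute\<close>)
qed

lemma lebesgue_integral_eq_lborel:
  fixes f f' :: "'a::euclidean_space \<Rightarrow> 'b::euclidean_space"
  assumes "f' \<in> borel_measurable borel" "AE t in lborel. f t = f' t"
  shows "integral\<^sup>L lebesgue f = integral\<^sup>L lborel f'"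
    and "integrable lebesgue f \<longleftrightarrow> integrable lborel f'"
proof -
  have meas: "f' \<in> borel_measurable lebesgue"
    using assms(1) by (intro measurable_completion) simp
  have AE: "AE t in lebesgue. f t = f' t"
    using assms(2) by (rule AE_completion)
  have f: "f \<in> borel_measurable lebesgue"
    using borel_measurable_AE[OF meas, of f] AE by (simp add: eq_commute)
  have "integral\<^sup>L lebesgue f = integral\<^sup>L lebesgue f'"
    by (intro integral_cong_AE f meas AE)
  then show "integral\<^sup>L lebesgue f = integral\<^sup>L lborel f'"
    using assms(1) by (simp add: integral_completion)
  have "integrable lebesgue f \<longleftrightarrow> integrable lebesgue f'"
    by (intro integrable_cong_AE f meas AE)
  then show "integrable lebesgue f \<longleftrightarrow> integrable lborel f'"
    using assms(1) by (simp add: integrable_completion)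
qed

lemma norm_integral_le_integral:
  fixes f :: "'a \<Rightarrow> 'b::{banach, second_countable_topology}"
  assumes "integrable M g" "AE x in M. norm (f x) \<le> g x"
  shows "norm (integral\<^sup>L M f) \<le> integral\<^sup>L M g"
proof (cases "integrable M f")
  case True
  have "norm (integral\<^sup>L M f) \<le> (\<integral>x. norm (f x) \<partial>M)"
    by (rule integral_norm_bound)
  also have "\<dots> \<le> integral\<^sup>L M g"
    using assms True by (intro integral_mono_AE) auto
  finally show ?thesis .
next
  case False
  have "0 \<le> integral\<^sup>L M g"
    using assms(2) by (intro integral_nonneg_AE) (auto elim!: eventually_mono intro: order_trans[OF norm_ge_zero])
  then show ?thesis
    using False by (simp add: not_integrable_integral_eq)
qed

lemma nn_integral_shift:
  fixes F :: "real \<Rightarrow> ennreal"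
  assumes "F \<in> borel_measurable borel"
  shows "(\<integral>\<^sup>+t. F (t + c) \<partial>lborel) = (\<integral>\<^sup>+t. F t \<partial>lborel)"
  using nn_integral_real_affine[OF assms, of 1 c] by (simp add: add.commute)

lemma integral_shift:
  fixes F :: "real \<Rightarrow> 'a::{banach, second_countable_topology}"
  shows "(\<integral>t. F (t + c) \<partial>lborel) = (\<integral>t. F t \<partial>lborel)"
  using lborel_integral_real_affine[of 1 F c] by (simp add: add.commute)

lemma integrable_shift:
  fixes F :: "real \<Rightarrow> 'a::{banach, second_countable_topology}"
  shows "integrable lborel (\<lambda>t. F (t + c)) \<longleftrightarrow> integrable lborel F"
  using lborel_integrable_real_affine_iff[of 1 F c] by (simp add: add.commute)

section \<open>Periodization\<close>

lemma lattice_point_unique: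
  fixes a t :: real
  assumes "0 < a"
  shows "t + a * of_int k \<in> {0..<a} \<longleftrightarrow> k = - \<lfloor>t / a\<rfloor>"
proof -
  have "t + a * of_int k \<in> {0..<a} \<longleftrightarrow> 0 \<le> t / a + of_int k \<and> t / a + of_int k < 1"
    using assms by (simp add: field_simps)
  also have "\<dots> \<longleftrightarrow> k = - \<lfloor>t / a\<rfloor>"
    by (auto simp: le_floor_iff floor_less_iff intro!: antisym) linarith+
  finally show ?thesis .
qed

text \<open>The translates of the half-open cell \<open>[0, a)\<close> tile the line without overlap.\<close>

lemma nn_integral_lattice_indicator:
  fixes a t :: real
  assumes "0 < a"
  shows "(\<integral>\<^sup>+k. indicator {0..<a} (t + a * of_int k) \<partial>count_space (UNIV::int set)) = (1::ennreal)"
proof -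
  have "indicator {0..<a} (t + a * of_int k) = (indicator {- \<lfloor>t / a\<rfloor>} k :: ennreal)" for k :: int
    using lattice_point_unique[OF assms, of t k] by (auto simp: indicator_def)
  then show ?thesis by simp
qed

text \<open>Insert the tiling by cells, exchange sum and integral, and translate every cell back to \<open>[0, a)\<close>.\<close>

lemma nn_integral_periodize:
  fixes F :: "real \<Rightarrow> ennreal"
  assumes "0 < a" and F [measurable]: "F \<in> borel_measurable borel"
  shows "(\<integral>\<^sup>+t. F t \<partial>lborel)
    = (\<integral>\<^sup>+t. indicator {0..<a} t * (\<integral>\<^sup>+k. F (t - a * of_int k) \<partial>count_space UNIV) \<partial>lborel)"
proof -
  have "(\<integral>\<^sup>+t. F t \<partial>lborel)
    = (\<integral>\<^sup>+t. \<integral>\<^sup>+k. indicator {0..<a} (t + a * of_int k) * F t \<partial>count_space (UNIV::int set) \<partial>lborel)"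
    by (simp add: nn_integral_multc nn_integral_lattice_indicator[OF assms(1)])
  also have "\<dots> = (\<integral>\<^sup>+k. \<integral>\<^sup>+t. indicator {0..<a} (t + a * of_int k) * F t \<partial>lborel \<partial>count_space (UNIV::int set))"
    by (rule nn_integral_count_space_nn_integral) auto
  also have "\<dots> = (\<integral>\<^sup>+k. \<integral>\<^sup>+t. indicator {0..<a} t * F (t - a * of_int k) \<partial>lborel \<partial>count_space (UNIV::int set))"
  proof (rule nn_integral_cong)
    fix k :: int
    show "(\<integral>\<^sup>+t. indicator {0..<a} (t + a * of_int k) * F t \<partial>lborel)
      = (\<integral>\<^sup>+t. indicator {0..<a} t * F (t - a * of_int k) \<partial>lborel)"
      using nn_integral_shift[of "\<lambda>t. indicator {0..<a} t * F (t - a * of_int k)" "a * of_int k"]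
      by simp
  qed
  also have "\<dots> = (\<integral>\<^sup>+t. \<integral>\<^sup>+k. indicator {0..<a} t * F (t - a * of_int k) \<partial>count_space (UNIV::int set) \<partial>lborel)"
    by (rule nn_integral_count_space_nn_integral[symmetric]) auto
  also have "\<dots> = (\<integral>\<^sup>+t. indicator {0..<a} t * (\<integral>\<^sup>+k. F (t - a * of_int k) \<partial>count_space UNIV) \<partial>lborel)"
    by (simp add: nn_integral_cmult)
  finally show ?thesis .
qed

lemma measurable_sum_lattice [measurable]:
  fixes F :: "real \<Rightarrow> ennreal"
  assumes [measurable]: "F \<in> borel_measurable borel"
  shows "(\<lambda>t. \<integral>\<^sup>+k. F (t - a * of_int k) \<partial>count_space (UNIV::int set)) \<in> borel_measurable borel"
proof -
  have "sigma_finite_measure (count_space (UNIV::int set))"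
    by (simp add: sigma_finite_measure_count_space_countable)
  moreover have "(\<lambda>(t, k). F (t - a * of_int k)) \<in> borel_measurable (borel \<Otimes>\<^sub>M count_space (UNIV::int set))"
    by measurable
  ultimately show ?thesis
    by (rule sigma_finite_measure.borel_measurable_nn_integral)
qed

text \<open>The same unfolding for integrable complex functions, where both exchanges of sum and integral need absolute convergence.
The sum over the lattice is written as an integral over the counting measure, so that Fubini's theorem applies.\<close>

lemma integral_periodize:
  fixes F :: "real \<Rightarrow> complex"
  assumes F: "integrable lborel F"
  shows "(LINT t:{0<..<1}|lborel. LINT k|count_space (UNIV::int set). F (t - of_int k)) = (\<integral>t. F t \<partial>lborel)"
proof -
  have [measurable]: "F \<in> borel_measurable borel" using F by auto
  interpret Z: sigma_finite_measure "count_space (UNIV::int set)"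
    by (simp add: sigma_finite_measure_count_space_countable)
  interpret P: pair_sigma_finite lborel "count_space (UNIV::int set)" ..
  let ?I = "indicator {0..<1::real} :: real \<Rightarrow> real"
  have ind: "?I (t + of_int k) = indicator {- \<lfloor>t\<rfloor>} k" for t :: real and k :: int
    using lattice_point_unique[of 1 t k] by (auto simp: indicator_def)
  have fin: "(\<integral>\<^sup>+t. ennreal (cmod (F t)) \<partial>lborel) < \<infinity>"
    using F by (simp add: integrable_iff_bounded)
  have "(\<integral>\<^sup>+t. \<integral>\<^sup>+k. ennreal (norm (?I t *\<^sub>R F (t - of_int k))) \<partial>count_space (UNIV::int set) \<partial>lborel)
      = (\<integral>\<^sup>+t. indicator {0..<1} t * (\<integral>\<^sup>+k. ennreal (cmod (F (t - 1 * of_int k))) \<partial>count_space (UNIV::int set)) \<partial>lborel)"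
    by (intro nn_integral_cong) (auto simp: indicator_def)
  also have "\<dots> < \<infinity>"
    using nn_integral_periodize[of 1 "\<lambda>t. ennreal (cmod (F t))"] fin by simp
  finally have "integrable (lborel \<Otimes>\<^sub>M count_space (UNIV::int set)) (\<lambda>(t, k). ?I t *\<^sub>R F (t - of_int k))"
    unfolding integrable_iff_bounded
    by (simp add: Z.nn_integral_fst[symmetric] split_beta')
  from P.Fubini_integral[OF this]
  have 1: "(\<integral>t. \<integral>k. ?I t *\<^sub>R F (t - of_int k) \<partial>count_space UNIV \<partial>lborel)
     = (\<integral>k. \<integral>t. ?I t *\<^sub>R F (t - of_int k) \<partial>lborel \<partial>count_space (UNIV::int set))" ..
  have "(\<integral>\<^sup>+t. \<integral>\<^sup>+k. ennreal (norm (?I (t + of_int k) *\<^sub>R F t)) \<partial>count_space (UNIV::int set) \<partial>lborel)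
     = (\<integral>\<^sup>+t. \<integral>\<^sup>+k. indicator {- \<lfloor>t\<rfloor>} k * ennreal (cmod (F t)) \<partial>count_space (UNIV::int set) \<partial>lborel)"
    unfolding ind by (intro nn_integral_cong) (auto simp: indicator_def)
  also have "\<dots> < \<infinity>"
    using fin by (simp add: nn_integral_multc)
  finally have "integrable (lborel \<Otimes>\<^sub>M count_space (UNIV::int set)) (\<lambda>(t, k). ?I (t + of_int k) *\<^sub>R F t)"
    unfolding integrable_iff_bounded
    by (simp add: Z.nn_integral_fst[symmetric] split_beta')
  from P.Fubini_integral[OF this]
  have 2: "(\<integral>t. \<integral>k. ?I (t + of_int k) *\<^sub>R F t \<partial>count_space (UNIV::int set) \<partial>lborel)
     = (\<integral>k. \<integral>t. ?I (t + of_int k) *\<^sub>R F t \<partial>lborel \<partial>count_space (UNIV::int set))" ..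
  have 3: "(\<integral>k. ?I (t + of_int k) *\<^sub>R F t \<partial>count_space (UNIV::int set)) = F t" for t
    unfolding ind by (simp add: integral_scaleR_left)
  have "(\<integral>t. ?I (t + of_int k) *\<^sub>R F t \<partial>lborel) = (\<integral>t. ?I t *\<^sub>R F (t - of_int k) \<partial>lborel)" for k :: int
    using integral_shift[of "\<lambda>t. ?I t *\<^sub>R F (t - of_int k)" "of_int k"] by simp
  then have 4: "(\<integral>t. \<integral>k. ?I t *\<^sub>R F (t - of_int k) \<partial>count_space (UNIV::int set) \<partial>lborel) = (\<integral>t. F t \<partial>lborel)"
    using 1 2 3 by simp
  have "AE t in lborel. t \<noteq> (0::real)" by (rule AE_lborel_singleton)
  then have 5: "(LINT t:{0<..<1}|lborel. LINT k|count_space (UNIV::int set). F (t - of_int k))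
     = (\<integral>t. \<integral>k. ?I t *\<^sub>R F (t - of_int k) \<partial>count_space (UNIV::int set) \<partial>lborel)"
    unfolding set_lebesgue_integral_def
    by (intro integral_cong_AE) (auto elim!: eventually_mono simp: indicator_def)
  then show ?thesis using 4 by simp
qed

section \<open>Functions with an integrable Fourier transform are bounded by its norm\<close>

text \<open>The Gaussian is its own Fourier transform, restated from its characteristic function.\<close>

lemma std_normal_density_fourier:
  "complex_of_real (std_normal_density z)
     = (LINT \<omega>|lborel. std_normal_density \<omega> *\<^sub>R cis (\<omega> * z)) / sqrt (2 * pi)"
proof -
  have "complex_of_real (exp (- (z^2) / 2)) = char std_normal_distribution z"
    by (simp add: char_std_normal_distribution)
  also have "\<dots> = (LINT \<omega>|lborel. std_normal_density \<omega> *\<^sub>R cis (\<omega> * z))"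
    unfolding char_def
    by (subst integral_density) (auto simp: cis_conv_exp mult_ac)
  finally show ?thesis
    by (simp add: std_normal_density_def divide_simps mult_ac flip: of_real_mult)
qed

text \<open>Fourier inversion holds for the Gaussian means of \<open>u\<close>, by Fubini's theorem alone: expand the Gaussian kernel as a Fourier
integral and exchange the integrals. The means are thereby integrals of the transform of \<open>u\<close> against a function
of modulus at most one, whatever \<open>\<epsilon>\<close> is.\<close>

lemma gaussian_mean_le_fourier_norm:
  fixes u :: "real \<Rightarrow> complex"
  defines "uhat \<equiv> \<lambda>\<xi>. LINT s|lborel. u s * cis (- (2 * pi * \<xi> * s))"
  assumes u: "integrable lborel u" and uhat: "integrable lborel uhat" and \<epsilon>: "0 < \<epsilon>"
  shows "cmod (LINT y|lborel. std_normal_density y *\<^sub>R u (t - \<epsilon> * y)) \<le> (LINT \<xi>|lborel. cmod (uhat \<xi>))"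
proof -
  have [measurable]: "u \<in> borel_measurable borel" using u by auto
  let ?n = std_normal_density
  define c where "c = complex_of_real (sqrt (2 * pi))"
  have cc: "c * c = complex_of_real (2 * pi)" "c \<noteq> 0"
    by (auto simp: c_def simp flip: of_real_mult)
  have n_int: "integrable lborel ?n" by simp
  have n_scaled: "integrable lborel (\<lambda>\<xi>. ?n (2 * pi * \<epsilon> * \<xi>))"
    using lborel_integrable_real_affine[OF n_int, of "2 * pi * \<epsilon>" 0] \<epsilon> by simp
  \<comment> \<open>the frequency is rescaled by \<open>2 \<pi> \<epsilon>\<close> so that the exponentials are those of \<open>uhat\<close>\<close>
  have kernel: "complex_of_real (?n ((t - s) / \<epsilon>))
      = c * \<epsilon> * (LINT \<xi>|lborel. ?n (2 * pi * \<epsilon> * \<xi>) *\<^sub>R cis (2 * pi * \<xi> * (t - s)))" for s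
  proof -
    have "(LINT \<omega>|lborel. ?n \<omega> *\<^sub>R cis (\<omega> * ((t - s) / \<epsilon>)))
      = (2 * pi * \<epsilon>) *\<^sub>R (LINT \<xi>|lborel. ?n (2 * pi * \<epsilon> * \<xi>) *\<^sub>R cis (2 * pi * \<xi> * (t - s)))"
      using \<epsilon> by (subst lborel_integral_real_affine[where c="2 * pi * \<epsilon>" and t=0])
        (auto intro!: Bochner_Integration.integral_cong arg_cong[where f=cis] simp: field_simps)
    also have "\<dots> = c * c * \<epsilon> * (LINT \<xi>|lborel. ?n (2 * pi * \<epsilon> * \<xi>) *\<^sub>R cis (2 * pi * \<xi> * (t - s)))"
      by (simp only: cc(1) scaleR_conv_of_real of_real_mult)
    finally show ?thesis
      unfolding std_normal_density_fourier c_def[symmetric] using cc(2) by simp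
  qed
  have "integrable (lborel \<Otimes>\<^sub>M lborel) (\<lambda>(s, \<xi>). ?n (2 * pi * \<epsilon> * \<xi>) *\<^sub>R (cis (2 * pi * \<xi> * (t - s)) * u s))"
  proof (rule lborel_pair.Fubini_integrable)
    show "integrable lborel (\<lambda>s. LINT \<xi>|lborel. norm (case (s, \<xi>) of (s, \<xi>) \<Rightarrow>
        ?n (2 * pi * \<epsilon> * \<xi>) *\<^sub>R (cis (2 * pi * \<xi> * (t - s)) * u s)))"
      using u by (simp add: norm_mult normal_density_nonneg)
    show "AE s in lborel. integrable lborel (\<lambda>\<xi>. case (s, \<xi>) of (s, \<xi>) \<Rightarrow>
        ?n (2 * pi * \<epsilon> * \<xi>) *\<^sub>R (cis (2 * pi * \<xi> * (t - s)) * u s))"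
    proof (rule AE_I2)
      fix s
      have "integrable lborel (\<lambda>\<xi>. ?n (2 * pi * \<epsilon> * \<xi>) * cmod (u s))"
        using n_scaled by simp
      then show "integrable lborel (\<lambda>\<xi>. case (s, \<xi>) of (s, \<xi>) \<Rightarrow>
          ?n (2 * pi * \<epsilon> * \<xi>) *\<^sub>R (cis (2 * pi * \<xi> * (t - s)) * u s))"
        by (rule Bochner_Integration.integrable_bound) (auto simp: norm_mult cis_conv_exp normal_density_nonneg)
    qed
  qed (simp add: cis_conv_exp)
  from lborel_pair.Fubini_integral[OF this]
  have swap: "(LINT s|lborel. LINT \<xi>|lborel. ?n (2 * pi * \<epsilon> * \<xi>) *\<^sub>R (cis (2 * pi * \<xi> * (t - s)) * u s))
      = (LINT \<xi>|lborel. LINT s|lborel. ?n (2 * pi * \<epsilon> * \<xi>) *\<^sub>R (cis (2 * pi * \<xi> * (t - s)) * u s))" ..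
  have inner: "(LINT s|lborel. ?n (2 * pi * \<epsilon> * \<xi>) *\<^sub>R (cis (2 * pi * \<xi> * (t - s)) * u s))
      = ?n (2 * pi * \<epsilon> * \<xi>) *\<^sub>R (cis (2 * pi * \<xi> * t) * uhat \<xi>)" for \<xi>
  proof -
    have "cis (2 * pi * \<xi> * (t - s)) * u s = cis (2 * pi * \<xi> * t) * (u s * cis (- (2 * pi * \<xi> * s)))" for s
      by (simp add: cis_mult algebra_simps)
    then show ?thesis
      by (simp only: uhat_def integral_scaleR_right integral_mult_right_zero)
  qed
  have "(LINT y|lborel. ?n y *\<^sub>R u (t - \<epsilon> * y)) = (LINT s|lborel. ?n ((t - s) / \<epsilon>) *\<^sub>R u s) / \<epsilon>"
    using \<epsilon> by (subst (2) lborel_integral_real_affine[where c="- \<epsilon>" and t=t])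
      (auto simp: scaleR_conv_of_real)
  also have "(LINT s|lborel. ?n ((t - s) / \<epsilon>) *\<^sub>R u s)
      = (LINT s|lborel. c * \<epsilon> * (LINT \<xi>|lborel. ?n (2 * pi * \<epsilon> * \<xi>) *\<^sub>R (cis (2 * pi * \<xi> * (t - s)) * u s)))"
  proof (rule Bochner_Integration.integral_cong[OF refl])
    fix s
    have "(LINT \<xi>|lborel. ?n (2 * pi * \<epsilon> * \<xi>) *\<^sub>R (cis (2 * pi * \<xi> * (t - s)) * u s))
      = (LINT \<xi>|lborel. ?n (2 * pi * \<epsilon> * \<xi>) *\<^sub>R cis (2 * pi * \<xi> * (t - s))) * u s"
      by (simp flip: integral_mult_left_zero)
    then show "?n ((t - s) / \<epsilon>) *\<^sub>R u s
       = c * \<epsilon> * (LINT \<xi>|lborel. ?n (2 * pi * \<epsilon> * \<xi>) *\<^sub>R (cis (2 * pi * \<xi> * (t - s)) * u s))"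
      unfolding scaleR_conv_of_real kernel by simp
  qed
  also have "\<dots> / \<epsilon> = c * (LINT \<xi>|lborel. ?n (2 * pi * \<epsilon> * \<xi>) *\<^sub>R (cis (2 * pi * \<xi> * t) * uhat \<xi>))"
    using \<epsilon> by (simp add: swap inner del: integral_scaleR_right)
  also have "cmod \<dots> \<le> sqrt (2 * pi) * (LINT \<xi>|lborel. cmod (uhat \<xi>) / sqrt (2 * pi))"
  proof -
    have "cmod (LINT \<xi>|lborel. ?n (2 * pi * \<epsilon> * \<xi>) *\<^sub>R (cis (2 * pi * \<xi> * t) * uhat \<xi>))
       \<le> (LINT \<xi>|lborel. cmod (uhat \<xi>) / sqrt (2 * pi))"
    proof (rule norm_integral_le_integral)
      show "integrable lborel (\<lambda>\<xi>. cmod (uhat \<xi>) / sqrt (2 * pi))" using uhat by simp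
    qed (auto simp: norm_mult std_normal_density_def mult_left_le_one_le divide_right_mono)
    moreover have "cmod c = sqrt (2 * pi)"
      by (simp add: c_def)
    ultimately show ?thesis
      by (simp only: norm_mult) (intro mult_left_mono, auto)
  qed
  also have "\<dots> = (LINT \<xi>|lborel. cmod (uhat \<xi>))"
    by simp
  finally show ?thesis .
qed

text \<open>Let \<open>\<epsilon>\<close> tend to \<open>0\<close> in the bound for Gaussian means. Pointwise convergence of the means is avoided by
integrating over an interval first: the integral of \<open>u\<close> over a moved interval depends continuously on the shift,
so the limit gives a bound for the mean of \<open>u\<close> over every interval, and Lebesgue's differentiation theorem returns to points.\<close>

lemma AE_le_fourier_norm:
  fixes u :: "real \<Rightarrow> complex"
  defines "uhat \<equiv> \<lambda>\<xi>. LINT s|lborel. u s * cis (- (2 * pi * \<xi> * s))"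
  assumes u: "integrable lborel u" and uhat: "integrable lborel uhat"
  shows "AE t in lborel. cmod (u t) \<le> (LINT \<xi>|lborel. cmod (uhat \<xi>))"
proof -
  have [measurable]: "u \<in> borel_measurable borel" using u by auto
  let ?n = std_normal_density
  define M where "M = (LINT \<xi>|lborel. cmod (uhat \<xi>))"
  have interval: "cmod (LINT t|lborel. indicator {p..q} t *\<^sub>R u t) \<le> (q - p) * M" if "p < q" for p q
  proof -
    let ?I = "indicator {p..q} :: real \<Rightarrow> real"
    define J where "J z = (LINT t|lborel. ?I t *\<^sub>R u (t - z))" for z
    have J: "J z = (LINT s|lborel. ?I (s + z) *\<^sub>R u s)" for z
      using integral_shift[of "\<lambda>t. ?I t *\<^sub>R u (t - z)" z] by (simp add: J_def)
    have [measurable]: "J \<in> borel_measurable borel"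
      unfolding J_def by measurable
    define U where "U = (LINT s|lborel. cmod (u s))"
    have J_bound: "cmod (J z) \<le> U" for z
      unfolding J U_def using u by (intro norm_integral_le_integral) (auto simp: indicator_def)
    have mean: "cmod (LINT y|lborel. ?n y *\<^sub>R J (\<epsilon> * y)) \<le> (q - p) * M" if \<epsilon>: "0 < \<epsilon>" for \<epsilon>
    proof -
      let ?f = "\<lambda>(y, t). ?n y *\<^sub>R (?I t *\<^sub>R u (t - \<epsilon> * y))"
      have sh: "integrable lborel (\<lambda>t. u (t - z))" for z
        using integrable_shift[of u "-z"] u by simp
      have shI: "integrable lborel (\<lambda>t. ?I t *\<^sub>R u (t - z))" for z
        by (rule Bochner_Integration.integrable_bound[OF sh[of z]]) (auto simp: indicator_def)
      have "integrable (lborel \<Otimes>\<^sub>M lborel) ?f"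
      proof (rule lborel_pair.Fubini_integrable)
        have "(LINT t|lborel. cmod (?I t *\<^sub>R u (t - z))) \<le> U" for z
        proof -
          have "(LINT t|lborel. cmod (?I t *\<^sub>R u (t - z))) \<le> (LINT t|lborel. cmod (u (t - z)))"
            by (rule integral_mono[OF integrable_norm[OF shI] integrable_norm[OF sh]])
              (auto simp: indicator_def)
          also have "\<dots> = U"
            using integral_shift[of "\<lambda>t. cmod (u t)" "-z"] by (simp add: U_def)
          finally show ?thesis .
        qed
        then have le: "\<bar>LINT t|lborel. cmod (?I t *\<^sub>R u (t - z))\<bar> \<le> U" for z
          by (subst abs_of_nonneg) (auto intro: Bochner_Integration.integral_nonneg)
        have "integrable lborel (\<lambda>y. ?n y * U)"
          by simp
        then have "integrable lborel (\<lambda>y. ?n y * (LINT t|lborel. cmod (?I t *\<^sub>R u (t - \<epsilon> * y))))"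
          by (rule Bochner_Integration.integrable_bound)
            (use order_trans[OF le abs_ge_self] in \<open>auto simp: abs_mult normal_density_nonneg intro!: mult_left_mono AE_I2\<close>)
        then show "integrable lborel (\<lambda>y. LINT t|lborel. norm (?f (y, t)))"
          by (simp add: normal_density_nonneg mult.assoc)
        show "AE y in lborel. integrable lborel (\<lambda>t. ?f (y, t))"
          unfolding split_conv by (intro AE_I2 integrable_scaleR_right shI)
      qed measurable
      from lborel_pair.Fubini_integral[OF this]
      have swap: "(LINT t|lborel. LINT y|lborel. ?n y *\<^sub>R (?I t *\<^sub>R u (t - \<epsilon> * y)))
          = (LINT y|lborel. LINT t|lborel. ?n y *\<^sub>R (?I t *\<^sub>R u (t - \<epsilon> * y)))"
        by (simp only: split_conv)
      have "(LINT y|lborel. ?n y *\<^sub>R (?I t *\<^sub>R u (t - \<epsilon> * y)))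
          = ?I t *\<^sub>R (LINT y|lborel. ?n y *\<^sub>R u (t - \<epsilon> * y))" for t
        by (simp only: scaleR_left_commute[of _ "?I t"] integral_scaleR_right)
      with swap have "(LINT y|lborel. ?n y *\<^sub>R J (\<epsilon> * y))
          = (LINT t|lborel. ?I t *\<^sub>R (LINT y|lborel. ?n y *\<^sub>R u (t - \<epsilon> * y)))"
        by (simp only: J_def integral_scaleR_right)
      also have "cmod \<dots> \<le> (LINT t|lborel. ?I t * M)"
      proof (rule norm_integral_le_integral)
        have "cmod (?I t *\<^sub>R (LINT y|lborel. ?n y *\<^sub>R u (t - \<epsilon> * y))) \<le> ?I t * M" for t
          using gaussian_mean_le_fourier_norm[OF u, of \<epsilon> t] uhat \<epsilon>
          by (simp add: uhat_def M_def mult_left_mono)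
        then show "AE t in lborel. cmod (?I t *\<^sub>R (LINT y|lborel. ?n y *\<^sub>R u (t - \<epsilon> * y))) \<le> ?I t * M"
          by simp
        show "integrable lborel (\<lambda>t. ?I t * M)"
          using \<open>p < q\<close> by (intro integrable_mult_left integrable_real_indicator) auto
      qed
      also have "\<dots> = (q - p) * M"
        using \<open>p < q\<close> by simp
      finally show ?thesis .
    qed
    \<comment> \<open>moving the interval changes its indicator, in the limit, at most at the two endpoints\<close>
    have J_lim: "(\<lambda>n. J (z n)) \<longlonglongrightarrow> J 0" if z: "z \<longlonglongrightarrow> 0" for z
      unfolding J
    proof (rule integral_dominated_convergence[where w="\<lambda>s. cmod (u s)"])
      have "AE s in lborel. s \<noteq> p" "AE s in lborel. s \<noteq> q"
        by (rule AE_lborel_singleton)+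
      then show "AE s in lborel. (\<lambda>n. ?I (s + z n) *\<^sub>R u s) \<longlonglongrightarrow> ?I (s + 0) *\<^sub>R u s"
      proof eventually_elim
        case (elim s)
        have sz: "(\<lambda>n. s + z n) \<longlonglongrightarrow> s"
          using tendsto_add[OF tendsto_const z, of s] by simp
        have "\<forall>\<^sub>F n in sequentially. ?I (s + z n) = ?I s"
        proof -
          consider "s < p" | "p < s" "s < q" | "q < s" using elim by linarith
          then show ?thesis
          proof cases
            case 1
            show ?thesis using order_tendstoD(2)[OF sz 1] by eventually_elim (use 1 in \<open>auto simp: indicator_def\<close>)
          next
            case 2
            show ?thesis using order_tendstoD(1)[OF sz 2(1)] order_tendstoD(2)[OF sz 2(2)]
              by eventually_elim (use 2 in \<open>auto simp: indicator_def\<close>)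
          next
            case 3
            show ?thesis using order_tendstoD(1)[OF sz 3] by eventually_elim (use 3 in \<open>auto simp: indicator_def\<close>)
          qed
        qed
        then have "\<forall>\<^sub>F n in sequentially. ?I (s + z n) *\<^sub>R u s = ?I (s + 0) *\<^sub>R u s"
          by eventually_elim simp
        then show ?case by (rule tendsto_eventually)
      qed
    qed (use u in \<open>auto simp: indicator_def\<close>)
    have "(\<lambda>n. LINT y|lborel. ?n y *\<^sub>R J (inverse (real (Suc n)) * y)) \<longlonglongrightarrow> (LINT y|lborel. ?n y *\<^sub>R J 0)"
    proof (rule integral_dominated_convergence[where w="\<lambda>y. ?n y * U"])
      have "(\<lambda>n. ?n y *\<^sub>R J (inverse (real (Suc n)) * y)) \<longlonglongrightarrow> ?n y *\<^sub>R J 0" for y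
        by (intro tendsto_scaleR tendsto_const J_lim tendsto_mult_left_zero LIMSEQ_inverse_real_of_nat)
      then show "AE y in lborel. (\<lambda>n. ?n y *\<^sub>R J (inverse (real (Suc n)) * y)) \<longlonglongrightarrow> ?n y *\<^sub>R J 0"
        by simp
      show "AE y in lborel. norm (?n y *\<^sub>R J (inverse (real (Suc n)) * y)) \<le> ?n y * U" for n
        using J_bound by (auto simp: normal_density_nonneg intro!: mult_left_mono)
    qed auto
    moreover have "(LINT y|lborel. ?n y *\<^sub>R J 0) = J 0"
      by simp
    ultimately have "(\<lambda>n. cmod (LINT y|lborel. ?n y *\<^sub>R J (inverse (real (Suc n)) * y))) \<longlonglongrightarrow> cmod (J 0)"
      by (metis tendsto_norm)
    then have "cmod (J 0) \<le> (q - p) * M"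
      by (rule LIMSEQ_le_const2) (use mean[of "inverse (real (Suc n))" for n] in auto)
    then show ?thesis by (simp add: J_def)
  qed
  have "u integrable_on cbox a b" for a b
    using integrable_on_lborel[OF u] by (rule integrable_on_subcbox) simp
  then obtain N where N: "negligible N" and diff: "\<And>x e. x \<notin> N \<Longrightarrow> 0 < e \<Longrightarrow>
     \<exists>d>0. \<forall>h. 0 < h \<and> h < d \<longrightarrow> norm (integral (cbox x (x + h *\<^sub>R One)) u /\<^sub>R h ^ DIM(real) - u x) < e"
    using integrable_ccontinuous_explicit by blast
  have le: "cmod (u x) \<le> M" if "x \<notin> N" for x
  proof (rule field_le_epsilon)
    fix e :: real assume "0 < e"
    from diff[OF that this] obtain d where d: "0 < d"
      "\<And>h. 0 < h \<Longrightarrow> h < d \<Longrightarrow> norm (integral {x..x + h} u /\<^sub>R h - u x) < e"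
      by auto
    define h where "h = d / 2"
    have h: "0 < h" "h < d" using d by (auto simp: h_def)
    have "set_integrable lborel {x..x + h} u"
      unfolding set_integrable_def
      by (rule Bochner_Integration.integrable_bound[OF u]) (auto simp: indicator_def)
    then have "integral {x..x + h} u = (LINT t|lborel. indicator {x..x + h} t *\<^sub>R u t)"
      using set_borel_integral_eq_integral(2) by (metis set_lebesgue_integral_def)
    with interval[of x "x + h"] h have "cmod (integral {x..x + h} u) \<le> h * M"
      by simp
    then have "cmod (integral {x..x + h} u /\<^sub>R h) \<le> M"
      using h by (simp add: field_simps)
    moreover have "cmod (u x) \<le> cmod (integral {x..x + h} u /\<^sub>R h) + cmod (integral {x..x + h} u /\<^sub>R h - u x)"
      by (metis norm_triangle_sub norm_minus_commute)
    ultimately show "cmod (u x) \<le> M + e"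
      using d(2)[OF h] by linarith
  qed
  have "AE x in lebesgue. x \<notin> N"
    using N by (intro AE_not_in) (simp add: negligible_iff_null_sets)
  then have "AE x in lborel. x \<notin> N"
    by (simp add: AE_completion_iff)
  then show ?thesis
    by eventually_elim (use le in \<open>simp add: M_def\<close>)
qed

section \<open>A Bessel inequality for windows with bounded lattice sums\<close>

text \<open>Quantitative membership in the Wiener amalgam space with local component \<open>L\<^sup>\<infinity>\<close> and global component \<open>\<ell>\<^sup>1\<close>. The bound is asked for at
every point, not only almost everywhere, so that the lattice sums converge absolutely wherever they are formed.\<close>

definition wiener_bound :: "real \<Rightarrow> real \<Rightarrow> (real \<Rightarrow> complex) \<Rightarrow> bool" where
  "wiener_bound a C G \<longleftrightarrow>
     (\<forall>t. (\<integral>\<^sup>+k. ennreal (cmod (G (t - a * of_int k))) \<partial>count_space (UNIV::int set)) \<le> ennreal C)"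

lemma wiener_bound_translation:
  "wiener_bound a C G \<Longrightarrow> wiener_bound a C (translation x G)"
proof -
  have "t - a * of_int k - x = t - x - a * of_int k" for t and k :: int
    by simp
  then show "wiener_bound a C G \<Longrightarrow> wiener_bound a C (translation x G)"
    by (simp only: wiener_bound_def translation_def) simp
qed

text \<open>Periodicity is required almost everywhere only, because it is applied to Borel representatives of quasi-periodic functions.\<close>

lemma nn_integral_periodic_mult:
  fixes P Q :: "real \<Rightarrow> ennreal"
  assumes "0 < a" and [measurable]: "P \<in> borel_measurable borel" "Q \<in> borel_measurable borel"
    and P: "\<And>k::int. AE t in lborel. P (t - a * of_int k) = P t"
  shows "(\<integral>\<^sup>+t. P t * Q t \<partial>lborel)
     = (\<integral>\<^sup>+t. indicator {0..<a} t * P t * (\<integral>\<^sup>+k. Q (t - a * of_int k) \<partial>count_space (UNIV::int set)) \<partial>lborel)"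
proof -
  have "(\<integral>\<^sup>+t. P t * Q t \<partial>lborel)
    = (\<integral>\<^sup>+t. indicator {0..<a} t * (\<integral>\<^sup>+k. P (t - a * of_int k) * Q (t - a * of_int k)
          \<partial>count_space (UNIV::int set)) \<partial>lborel)"
    by (rule nn_integral_periodize[OF \<open>0 < a\<close>]) auto
  also have "\<dots> = (\<integral>\<^sup>+t. indicator {0..<a} t * P t * (\<integral>\<^sup>+k. Q (t - a * of_int k) \<partial>count_space (UNIV::int set)) \<partial>lborel)"
  proof (rule nn_integral_cong_AE)
    have "AE t in lborel. \<forall>k::int. P (t - a * of_int k) = P t"
      using P by (simp add: AE_all_countable)
    then show "AE t in lborel. indicator {0..<a} t * (\<integral>\<^sup>+k. P (t - a * of_int k) * Q (t - a * of_int k)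
          \<partial>count_space (UNIV::int set))
        = indicator {0..<a} t * P t * (\<integral>\<^sup>+k. Q (t - a * of_int k) \<partial>count_space (UNIV::int set))"
      by eventually_elim (simp add: nn_integral_cmult mult.assoc)
  qed
  finally show ?thesis .
qed

lemma nn_integral_periodic_mult_le:
  fixes P :: "real \<Rightarrow> real"
  assumes "0 < a" and [measurable]: "G \<in> borel_measurable borel" "P \<in> borel_measurable borel"
    and G: "wiener_bound a C G" and "0 \<le> C"
    and P: "\<And>k::int. AE t in lborel. P (t - a * of_int k) = P t" "\<And>t. 0 \<le> P t"
  shows "(\<integral>\<^sup>+t. ennreal (P t * cmod (G t)) \<partial>lborel)
     \<le> ennreal C * (\<integral>\<^sup>+t. indicator {0..<a} t * ennreal (P t) \<partial>lborel)"
proof -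
  have per: "AE t in lborel. ennreal (P (t - a * of_int k)) = ennreal (P t)" for k :: int
    using P(1)[of k] by eventually_elim simp
  have "(\<integral>\<^sup>+t. ennreal (P t * cmod (G t)) \<partial>lborel) = (\<integral>\<^sup>+t. ennreal (P t) * ennreal (cmod (G t)) \<partial>lborel)"
    using P(2) by (simp add: ennreal_mult)
  also have "\<dots> = (\<integral>\<^sup>+t. indicator {0..<a} t * ennreal (P t)
      * (\<integral>\<^sup>+k. ennreal (cmod (G (t - a * of_int k))) \<partial>count_space (UNIV::int set)) \<partial>lborel)"
    using per by (intro nn_integral_periodic_mult[OF \<open>0 < a\<close>]) auto
  also have "\<dots> \<le> (\<integral>\<^sup>+t. indicator {0..<a} t * ennreal (P t) * ennreal C \<partial>lborel)"
    using G by (intro nn_integral_mono mult_left_mono) (auto simp: wiener_bound_def)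
  also have "\<dots> = ennreal C * (\<integral>\<^sup>+t. indicator {0..<a} t * ennreal (P t) \<partial>lborel)"
    by (subst nn_integral_multc) (auto simp: mult.commute)
  finally show ?thesis .
qed

lemma wiener_bound_integrable:
  assumes "0 < a" "G \<in> borel_measurable borel" "wiener_bound a C G" "0 \<le> C"
  shows "integrable lborel G"
proof -
  have "(\<integral>\<^sup>+t. ennreal (1 * cmod (G t)) \<partial>lborel)
     \<le> ennreal C * (\<integral>\<^sup>+t. indicator {0..<a} t * ennreal 1 \<partial>lborel)"
    using assms by (intro nn_integral_periodic_mult_le) auto
  also have "\<dots> < \<infinity>"
    using assms(1) by (simp add: nn_integral_indicator ennreal_mult_less_top)
  finally show ?thesis
    using assms(2) by (simp add: integrable_iff_bounded)
qed

text \<open>Orthogonality of the exponentials of frequencies in \<open>\<beta> \<int>\<close> on an interval of length \<open>1 / \<beta>\<close>.\<close>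

lemma integral_cis_period:
  fixes m :: int
  assumes "0 < \<beta>"
  shows "(LINT t|lborel. indicator {0..1/\<beta>} t *\<^sub>R cis (2 * pi * (\<beta> * of_int m) * t)) = (if m = 0 then 1 / \<beta> else 0)"
proof (cases "m = 0")
  case False
  define w where "w = 2 * pi * (\<beta> * of_int m)"
  have w: "w \<noteq> 0" using False assms by (simp add: w_def)
  have deriv: "((\<lambda>t. cis (w * t) / (\<i> * w)) has_vector_derivative cis (w * t)) (at t within S)" for t S
  proof -
    have "((\<lambda>t. cis (w * t)) has_vector_derivative w *\<^sub>R (\<i> * cis (w * t))) (at t within S)"
    proof -
      have "((\<lambda>z. exp (\<i> * (of_real w * z))) has_field_derivative
          (of_real w * (\<i> * exp (\<i> * (of_real w * of_real t))))) (at (of_real t))"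
        by (auto intro!: derivative_eq_intros)
      from has_vector_derivative_real_field[OF this] show ?thesis
        by (simp add: cis_conv_exp scaleR_conv_of_real)
    qed
    from has_vector_derivative_mult_left[OF this, of "1 / (\<i> * w)"] show ?thesis
      using w by (simp add: scaleR_conv_of_real field_simps)
  qed
  have "has_bochner_integral lborel (\<lambda>t. indicator {0..1/\<beta>} t *\<^sub>R cis (w * t))
      (cis (w * (1/\<beta>)) / (\<i> * w) - cis (w * 0) / (\<i> * w))"
    using assms by (intro has_bochner_integral_FTC_Icc deriv) (auto intro!: continuous_intros simp: cis_conv_exp)
  moreover have "w * (1/\<beta>) = 2 * pi * of_int m"
    using assms by (simp add: w_def)
  then have "cis (w * (1/\<beta>)) = 1"
    by (simp only: cis_multiple_2pi[OF Ints_of_int])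
  ultimately show ?thesis
    using False by (simp add: has_bochner_integral_iff w_def)
next
  case True
  have "(LINT t|lborel. indicator {0..1/\<beta>} t *\<^sub>R (1::complex)) = measure lborel {0..1/\<beta>} *\<^sub>R 1"
    by simp
  then show ?thesis
    using assms True by (simp add: of_real_def)
qed

lemma trig_poly_norm:
  fixes N :: "int set" and c :: "int \<Rightarrow> complex"
  assumes "0 < \<beta>" "finite N"
  shows "(LINT t|lborel. indicator {0..1/\<beta>} t * (cmod (\<Sum>n\<in>N. c n * cis (2 * pi * (\<beta> * of_int n) * t)))\<^sup>2)
     = (\<Sum>n\<in>N. (cmod (c n))\<^sup>2) / \<beta>"
proof -
  let ?T = "\<lambda>t. \<Sum>n\<in>N. c n * cis (2 * pi * (\<beta> * of_int n) * t)"
  let ?I = "indicator {0..1/\<beta>} :: real \<Rightarrow> real"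
  have int: "integrable lborel (\<lambda>t. ?I t *\<^sub>R cis (2 * pi * (\<beta> * of_int m) * t))" for m :: int
    by (rule Bochner_Integration.integrable_bound[where f="?I"])
      (use assms(1) in auto)
  define K where "K n m t = (c n * cnj (c m)) * (?I t *\<^sub>R cis (2 * pi * (\<beta> * of_int (n - m)) * t))" for n m t
  have K: "integrable lborel (K n m)" for n m
    unfolding K_def by (intro Bochner_Integration.integrable_mult_right int)
  have K_integral: "integral\<^sup>L lborel (K n m) = (if m = n then c n * cnj (c n) / \<beta> else 0)" for n m
    unfolding K_def integral_mult_right_zero integral_cis_period[OF assms(1)] by simp
  have expand: "complex_of_real (?I t * (cmod (?T t))\<^sup>2) = (\<Sum>n\<in>N. \<Sum>m\<in>N. K n m t)" for t
  proof -
    have "complex_of_real ((cmod (?T t))\<^sup>2) = ?T t * cnj (?T t)"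
      by (rule complex_norm_square)
    also have "\<dots> = (\<Sum>n\<in>N. \<Sum>m\<in>N. c n * cis (2 * pi * (\<beta> * of_int n) * t) * cnj (c m * cis (2 * pi * (\<beta> * of_int m) * t)))"
      by (simp only: sum_product cnj_sum)
    finally have sq: "complex_of_real ((cmod (?T t))\<^sup>2)
      = (\<Sum>n\<in>N. \<Sum>m\<in>N. c n * cis (2 * pi * (\<beta> * of_int n) * t) * cnj (c m * cis (2 * pi * (\<beta> * of_int m) * t)))" .
    have "complex_of_real (?I t) * (c n * cis (2 * pi * (\<beta> * of_int n) * t) * cnj (c m * cis (2 * pi * (\<beta> * of_int m) * t))) = K n m t" for n m
    proof -
      have "cis (2 * pi * (\<beta> * of_int (n - m)) * t)
          = cis (2 * pi * (\<beta> * of_int n) * t) * cnj (cis (2 * pi * (\<beta> * of_int m) * t))"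
        by (simp add: cis_cnj cis_mult algebra_simps)
      then show ?thesis
        by (simp only: K_def scaleR_conv_of_real complex_cnj_mult mult_ac)
    qed
    then show ?thesis
      by (simp only: of_real_mult sq sum_distrib_left)
  qed
  have "complex_of_real (LINT t|lborel. ?I t * (cmod (?T t))\<^sup>2)
     = (LINT t|lborel. complex_of_real (?I t * (cmod (?T t))\<^sup>2))"
    by (rule integral_complex_of_real[symmetric])
  also have "\<dots> = (\<Sum>n\<in>N. \<Sum>m\<in>N. integral\<^sup>L lborel (K n m))"
    unfolding expand by (simp add: Bochner_Integration.integral_sum Bochner_Integration.integrable_sum K)
  also have "\<dots> = (\<Sum>n\<in>N. c n * cnj (c n)) / \<beta>"
    unfolding K_integral using assms(2) by (simp add: sum_divide_distrib)
  also have "\<dots> = complex_of_real ((\<Sum>n\<in>N. (cmod (c n))\<^sup>2) / \<beta>)"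
    by (simp only: of_real_divide of_real_sum complex_norm_square)
  finally show ?thesis
    using of_real_eq_iff by blast
qed

text \<open>The inequality between arithmetic and geometric means with a free weight \<open>r\<close>; it replaces the Cauchy-Schwarz inequality when
the best \<open>r\<close> is known in advance.\<close>

lemma mult_le_weighted_squares:
  fixes x y r :: real
  assumes "0 < r"
  shows "x * y \<le> (r * x\<^sup>2 + y\<^sup>2 / r) / 2"
proof -
  have "0 \<le> (r * x - y)\<^sup>2 / r" using assms by simp
  also have "\<dots> = r * x\<^sup>2 - 2 * (x * y) + y\<^sup>2 / r"
    using assms by (simp add: power2_eq_square field_simps)
  finally show ?thesis by simp
qed

lemma borel_measurable_modulation [measurable]:
  "G \<in> borel_measurable borel \<Longrightarrow> modulation \<xi> G \<in> borel_measurable borel"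
  unfolding modulation_def by measurable

lemma norm_modulation [simp]: "cmod (modulation \<xi> G t) = cmod (G t)"
  by (simp add: modulation_def norm_mult)

lemma integrable_mult_cnj_modulation:
  fixes h G :: "real \<Rightarrow> complex"
  assumes [measurable]: "h \<in> borel_measurable borel"
    and G: "integrable lborel G" and hG: "integrable lborel (\<lambda>t. (cmod (h t))\<^sup>2 * cmod (G t))"
  shows "integrable lborel (\<lambda>t. h t * cnj (modulation \<xi> G t))"
proof (rule Bochner_Integration.integrable_bound)
  have [measurable]: "G \<in> borel_measurable borel" using G by auto
  show "(\<lambda>t. h t * cnj (modulation \<xi> G t)) \<in> borel_measurable lborel"
    by measurable
  show "integrable lborel (\<lambda>t. ((cmod (h t))\<^sup>2 * cmod (G t) + cmod (G t)) / 2)"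
    using hG G by simp
  have "cmod (h t) * cmod (G t) \<le> ((cmod (h t))\<^sup>2 * cmod (G t) + cmod (G t)) / 2" for t
    using mult_right_mono[OF mult_le_weighted_squares[of 1 "cmod (h t)" 1] norm_ge_zero[of "G t"]]
    by (simp add: algebra_simps)
  then show "AE t in lborel. norm (h t * cnj (modulation \<xi> G t))
      \<le> norm (((cmod (h t))\<^sup>2 * cmod (G t) + cmod (G t)) / 2)"
    by (auto simp: norm_mult intro: order_trans[OF _ abs_ge_self])
qed

text \<open>A duality argument. With the trigonometric polynomial \<open>T = \<Sum> c\<^sub>n exp (2 \<pi> \<i> \<beta> n t)\<close> over \<open>N\<close> one has
\<open>S = \<Sum>|c\<^sub>n|\<^sup>2 = \<integral> h cnj (G) cnj (T)\<close>. Splitting the integrand into parts with \<open>|h|\<^sup>2 |G|\<close> and \<open>|T|\<^sup>2 |G|\<close>,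
the second part is at most \<open>C\<close> times the integral of \<open>|T|\<^sup>2\<close> over one period, hence at most \<open>C S / \<beta>\<close>. With the
weight \<open>C / \<beta>\<close> it contributes \<open>S / 2\<close>, which is absorbed on the left.\<close>

lemma wiener_bessel:
  fixes h G :: "real \<Rightarrow> complex" and N :: "int set" and \<beta> :: real
  defines "c \<equiv> \<lambda>n::int. LINT t|lborel. h t * cnj (modulation (\<beta> * of_int n) G t)"
  assumes \<beta>: "0 < \<beta>" and G [measurable]: "G \<in> borel_measurable borel"
    and h [measurable]: "h \<in> borel_measurable borel"
    and C: "wiener_bound (1 / \<beta>) C G" "0 < C"
    and hG: "integrable lborel (\<lambda>t. (cmod (h t))\<^sup>2 * cmod (G t))"
    and N: "finite N"
  shows "(\<Sum>n\<in>N. (cmod (c n))\<^sup>2) \<le> C / \<beta> * (LINT t|lborel. (cmod (h t))\<^sup>2 * cmod (G t))"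
proof -
  define T where "T t = (\<Sum>n\<in>N. c n * cis (2 * pi * (\<beta> * of_int n) * t))" for t
  define S where "S = (\<Sum>n\<in>N. (cmod (c n))\<^sup>2)"
  define E where "E = (LINT t|lborel. (cmod (h t))\<^sup>2 * cmod (G t))"
  have [measurable]: "T \<in> borel_measurable borel"
    unfolding T_def by measurable
  have G_int: "integrable lborel G"
    using \<beta> C by (intro wiener_bound_integrable[of "1 / \<beta>" G C]) auto
  have hG_int: "integrable lborel (\<lambda>t. h t * cnj (modulation (\<beta> * of_int n) G t))" for n
    using G_int hG by (intro integrable_mult_cnj_modulation) auto
  \<comment> \<open>all frequencies of \<open>T\<close> are integer multiples of \<open>\<beta>\<close>, so \<open>1 / \<beta>\<close> is a period\<close>
  have T_per: "T (t - 1 / \<beta> * of_int k) = T t" for t k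
  proof -
    have "cis (2 * pi * (\<beta> * of_int n) * (t - 1 / \<beta> * of_int k)) = cis (2 * pi * (\<beta> * of_int n) * t)" for n
    proof -
      have "2 * pi * (\<beta> * of_int n) * (t - 1 / \<beta> * of_int k) = 2 * pi * (\<beta> * of_int n) * t + 2 * pi * of_int (- (n * k))"
        using \<beta> by (simp add: field_simps)
      then show ?thesis
        by (simp only: cis_mult[symmetric] cis_multiple_2pi[OF Ints_of_int] mult_1_right)
    qed
    then show ?thesis by (simp add: T_def)
  qed
  have T_norm: "(LINT t|lborel. indicator {0..1/\<beta>} t * (cmod (T t))\<^sup>2) = S / \<beta>"
    unfolding T_def S_def by (rule trig_poly_norm[OF \<beta> N])
  have T_cont: "continuous_on {0..1/\<beta>} (\<lambda>t. (cmod (T t))\<^sup>2)"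
    unfolding T_def cis_conv_exp by (intro continuous_intros)
  have T_int: "integrable lborel (\<lambda>t. indicator {0..1/\<beta>} t * (cmod (T t))\<^sup>2)"
    using borel_integrable_compact[OF compact_Icc T_cont] by (simp add: indicator_def if_distrib cong: if_cong)
  have S_nn: "0 \<le> S" by (simp add: S_def sum_nonneg)
  have "(\<integral>\<^sup>+t. ennreal ((cmod (T t))\<^sup>2 * cmod (G t)) \<partial>lborel)
      \<le> ennreal C * (\<integral>\<^sup>+t. indicator {0..<1/\<beta>} t * ennreal ((cmod (T t))\<^sup>2) \<partial>lborel)"
    using \<beta> C T_per by (intro nn_integral_periodic_mult_le) (auto simp: T_per)
  also have "\<dots> \<le> ennreal C * (\<integral>\<^sup>+t. ennreal (indicator {0..1/\<beta>} t * (cmod (T t))\<^sup>2) \<partial>lborel)"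
    by (intro mult_left_mono nn_integral_mono) (auto simp: indicator_def)
  also have "(\<integral>\<^sup>+t. ennreal (indicator {0..1/\<beta>} t * (cmod (T t))\<^sup>2) \<partial>lborel) = ennreal (S / \<beta>)"
    by (subst nn_integral_eq_integral[OF T_int]) (auto simp: T_norm)
  also have "ennreal C * ennreal (S / \<beta>) = ennreal (C * (S / \<beta>))"
    using C(2) S_nn \<beta> by (simp add: ennreal_mult[symmetric])
  finally have TG: "(\<integral>\<^sup>+t. ennreal ((cmod (T t))\<^sup>2 * cmod (G t)) \<partial>lborel) \<le> ennreal (C * (S / \<beta>))" .
  then have TG_int: "integrable lborel (\<lambda>t. (cmod (T t))\<^sup>2 * cmod (G t))"
    by (auto simp: integrable_iff_bounded intro: le_less_trans)
  have TG_le: "(LINT t|lborel. (cmod (T t))\<^sup>2 * cmod (G t)) \<le> C * (S / \<beta>)"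
    using TG TG_int C(2) S_nn \<beta> by (simp add: nn_integral_eq_integral)
  have "complex_of_real S = (\<Sum>n\<in>N. c n * cnj (c n))"
    by (simp only: S_def of_real_sum complex_norm_square)
  also have "\<dots> = (\<Sum>n\<in>N. cnj (c n) * (LINT t|lborel. h t * cnj (modulation (\<beta> * of_int n) G t)))"
    by (simp add: c_def mult.commute)
  also have "\<dots> = integral\<^sup>L lborel (\<lambda>t. \<Sum>n\<in>N. cnj (c n) * (h t * cnj (modulation (\<beta> * of_int n) G t)))"
    using hG_int by (subst Bochner_Integration.integral_sum) auto
  also have "\<dots> = (LINT t|lborel. h t * cnj (G t) * cnj (T t))"
    by (intro Bochner_Integration.integral_cong refl)
      (simp add: T_def modulation_def sum_distrib_left mult_ac)
  finally have "S = cmod (LINT t|lborel. h t * cnj (G t) * cnj (T t))"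
    using S_nn by (metis norm_of_real abs_of_nonneg)
  also have "\<dots> \<le> (LINT t|lborel. (C / \<beta> * ((cmod (h t))\<^sup>2 * cmod (G t)) + \<beta> / C * ((cmod (T t))\<^sup>2 * cmod (G t))) / 2)"
  proof (rule norm_integral_le_integral)
    show "integrable lborel (\<lambda>t. (C / \<beta> * ((cmod (h t))\<^sup>2 * cmod (G t)) + \<beta> / C * ((cmod (T t))\<^sup>2 * cmod (G t))) / 2)"
      using hG TG_int by simp
    have "cmod (h t) * cmod (T t) * cmod (G t) \<le> (C / \<beta> * (cmod (h t))\<^sup>2 + (cmod (T t))\<^sup>2 / (C / \<beta>)) / 2 * cmod (G t)" for t
      using \<beta> C(2) by (intro mult_right_mono mult_le_weighted_squares) auto
    then have "cmod (h t) * cmod (T t) * cmod (G t)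
       \<le> (C / \<beta> * ((cmod (h t))\<^sup>2 * cmod (G t)) + \<beta> / C * ((cmod (T t))\<^sup>2 * cmod (G t))) / 2" for t
      by (simp add: algebra_simps add_divide_distrib)
    then show "AE t in lborel. norm (h t * cnj (G t) * cnj (T t))
       \<le> (C / \<beta> * ((cmod (h t))\<^sup>2 * cmod (G t)) + \<beta> / C * ((cmod (T t))\<^sup>2 * cmod (G t))) / 2"
      by (simp add: norm_mult mult_ac)
  qed
  also have "\<dots> = (C / \<beta> * E + \<beta> / C * (LINT t|lborel. (cmod (T t))\<^sup>2 * cmod (G t))) / 2"
    using hG TG_int by (simp add: E_def)
  also have "\<dots> \<le> (C / \<beta> * E + S) / 2"
  proof -
    have "\<beta> / C * (LINT t|lborel. (cmod (T t))\<^sup>2 * cmod (G t)) \<le> S"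
      using mult_left_mono[OF TG_le, of "\<beta> / C"] \<beta> C(2) by simp
    then show ?thesis by (intro divide_right_mono add_left_mono) auto
  qed
  finally show ?thesis
    by (simp add: S_def E_def)
qed

section \<open>Feichtinger's algebra has bounded lattice sums\<close>

lemma norm_h0: "cmod (h0 r) = 2 powr (1/4) * exp (- (pi * r\<^sup>2))"
  by (simp add: h0_def norm_mult)

lemma borel_measurable_h0 [measurable]: "h0 \<in> borel_measurable borel"
  unfolding h0_def by measurable

lemma h0_square_integrable: "integrable lborel (\<lambda>r. (cmod (h0 r))\<^sup>2)"
proof -
  \<comment> \<open>\<open>h0\<^sup>2\<close> is a multiple of the standard normal density, dilated by \<open>2 sqrt \<pi>\<close>\<close>
  let ?c = "(2 powr (1/4))\<^sup>2 * sqrt (2 * pi)"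
  have "integrable lborel (\<lambda>r. ?c * std_normal_density (0 + 2 * sqrt pi * r))"
    by (intro integrable_mult_right lborel_integrable_real_affine) auto
  moreover have "?c * std_normal_density (0 + 2 * sqrt pi * r) = (cmod (h0 r))\<^sup>2" for r
    by (simp add: norm_h0 std_normal_density_def power_mult_distrib flip: exp_double)
  ultimately show ?thesis
    by (simp only:)
qed

text \<open>For fixed \<open>x\<close> the short-time Fourier transform is the Fourier transform of \<open>g\<close> multiplied by a translated Gaussian, and for almost
every \<open>x\<close> it is integrable in the frequency. So \<open>AE_le_fourier_norm\<close> applies, with \<open>F (x)\<close> the norm in the frequency
variable. The quantifiers are exchanged at the end because the bound is needed at a fixed \<open>t\<close>, for almost all \<open>x\<close>.\<close>

lemma feichtinger_pointwise_bound:
  assumes g: "g \<in> feichtinger_algebra"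
    and g0 [measurable]: "g0 \<in> borel_measurable borel" and eq: "AE t in lborel. g t = g0 t"
  obtains F where "integrable lborel F"
    "AE t in lborel. AE x in lborel. cmod (g0 t) * cmod (h0 (t - x)) \<le> F x"
proof
  define V where "V x \<xi> = (LINT s|lborel. g0 s * h0 (s - x) * cis (- (2 * pi * \<xi> * s)))" for x \<xi>
  define F where "F x = (LINT \<xi>|lborel. cmod (V x \<xi>))" for x
  have cnj_h0: "cnj (h0 r) = h0 r" for r
    by (simp add: h0_def)
  have stft: "stft h0 g x \<xi> = V x \<xi>" for x \<xi>
    unfolding stft_def V_def cnj_h0
    by (rule lebesgue_integral_eq_lborel(1)) (use eq in auto)
  have meas: "(\<lambda>p. V (fst p) (snd p)) \<in> borel_measurable (borel \<Otimes>\<^sub>M borel)"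
    unfolding V_def by measurable
  have "integrable lebesgue (\<lambda>p. V (fst p) (snd p))"
    using g by (simp add: feichtinger_algebra_def stft split_beta')
  moreover have "(\<lambda>p. V (fst p) (snd p)) \<in> borel_measurable lborel"
    using meas by (simp add: borel_prod)
  ultimately have "integrable (lborel :: (real \<times> real) measure) (\<lambda>p. V (fst p) (snd p))"
    by (simp add: integrable_completion)
  then have int: "integrable (lborel \<Otimes>\<^sub>M lborel) (\<lambda>p. V (fst p) (snd p))"
    by (simp add: lborel_prod)
  show F_int: "integrable lborel F"
    using lborel_pair.integrable_fst'[OF integrable_norm[OF int]] by (simp add: F_def[abs_def])
  have [measurable]: "F \<in> borel_measurable borel"
    using F_int by auto
  have g0_sq: "integrable lborel (\<lambda>t. (cmod (g0 t))\<^sup>2)"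
  proof -
    have "integrable lebesgue (\<lambda>t. (cmod (g t))\<^sup>2)"
      using g by (simp add: feichtinger_algebra_def L2_def)
    then show ?thesis
      using eq by (subst (asm) lebesgue_integral_eq_lborel(2)[where f'="\<lambda>t. (cmod (g0 t))\<^sup>2"]) auto
  qed
  have win: "integrable lborel (\<lambda>s. g0 s * h0 (s - x))" for x
  proof (rule Bochner_Integration.integrable_bound)
    have "integrable lborel (\<lambda>s. (cmod (h0 (s - x)))\<^sup>2)"
      using integrable_shift[of "\<lambda>s. (cmod (h0 s))\<^sup>2" "-x"] h0_square_integrable by simp
    then show "integrable lborel (\<lambda>s. (1 * (cmod (g0 s))\<^sup>2 + (cmod (h0 (s - x)))\<^sup>2 / 1) / 2)"
      using g0_sq by simp
    show "AE s in lborel. norm (g0 s * h0 (s - x)) \<le> norm ((1 * (cmod (g0 s))\<^sup>2 + (cmod (h0 (s - x)))\<^sup>2 / 1) / 2)"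
      unfolding norm_mult real_norm_def
      by (intro AE_I2 order_trans[OF mult_le_weighted_squares abs_ge_self]) simp
  qed measurable
  have "AE x in lborel. integrable lborel (\<lambda>\<xi>. V x \<xi>)"
    using lborel_pair.AE_integrable_fst'[OF int] by simp
  then have "AE x in lborel. AE t in lborel. cmod (g0 t) * cmod (h0 (t - x)) \<le> F x"
  proof eventually_elim
    case (elim x)
    show ?case
      using AE_le_fourier_norm[OF win[of x]] elim by (simp add: V_def F_def norm_mult)
  qed
  moreover have "{p \<in> space (lborel \<Otimes>\<^sub>M lborel). cmod (g0 (snd p)) * cmod (h0 (snd p - fst p)) \<le> F (fst p)}
      \<in> sets (lborel \<Otimes>\<^sub>M lborel)"
    by measurable
  ultimately show "AE t in lborel. AE x in lborel. cmod (g0 t) * cmod (h0 (t - x)) \<le> F x"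
    by (subst (asm) lborel_pair.AE_commute)
qed

text \<open>Integrate the pointwise bound at \<open>t - a k\<close> over the \<open>x\<close> in a cell of length \<open>a\<close> next to that point, where the Gaussian is at least
\<open>m = h0 (a) > 0\<close>. For different \<open>k\<close> these cells are disjoint, so that the sum over \<open>k\<close> is at most \<open>\<integral> F / (a m)\<close>.\<close>

lemma feichtinger_AE_lattice_sum_bound:
  assumes g: "g \<in> feichtinger_algebra" and a: "0 < a"
    and g0 [measurable]: "g0 \<in> borel_measurable borel" and eq: "AE t in lborel. g t = g0 t"
  obtains C where "0 \<le> C"
    "AE t in lborel. (\<integral>\<^sup>+k. ennreal (cmod (g0 (t - a * of_int k))) \<partial>count_space (UNIV::int set)) \<le> ennreal C"
proof -
  obtain F where F: "integrable lborel F"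
    and bound: "AE t in lborel. AE x in lborel. cmod (g0 t) * cmod (h0 (t - x)) \<le> F x"
    using feichtinger_pointwise_bound[OF g g0 eq] .
  have [measurable]: "F \<in> borel_measurable borel" using F by auto
  define m where "m = cmod (h0 a)"
  have m: "0 < m" by (simp add: m_def norm_h0)
  have m_le: "m \<le> cmod (h0 r)" if "\<bar>r\<bar> \<le> a" for r
  proof -
    have "r\<^sup>2 \<le> a\<^sup>2" using that a by (simp add: abs_le_square_iff[symmetric])
    then show ?thesis by (simp add: m_def norm_h0)
  qed
  define I where "I = (\<integral>\<^sup>+x. ennreal (F x) \<partial>lborel)"
  have I: "I < \<infinity>"
  proof -
    have "I \<le> (\<integral>\<^sup>+x. ennreal (norm (F x)) \<partial>lborel)"
      unfolding I_def by (intro nn_integral_mono ennreal_leI) simp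
    also have "\<dots> < \<infinity>"
      using F by (simp add: integrable_iff_bounded)
    finally show ?thesis .
  qed
  show thesis
  proof
    show "0 \<le> enn2real I / (a * m)"
      using a m by simp
    have "AE t in lborel. \<forall>k::int. AE x in lborel. cmod (g0 (t - a * of_int k)) * cmod (h0 (t - a * of_int k - x)) \<le> F x"
      unfolding AE_all_countable
    proof
      fix k :: int
      show "AE t in lborel. AE x in lborel. cmod (g0 (t - a * of_int k)) * cmod (h0 (t - a * of_int k - x)) \<le> F x"
        using AE_lborel_shift[OF bound, of "- (a * of_int k)"] by simp
    qed
    then show "AE t in lborel. (\<integral>\<^sup>+k. ennreal (cmod (g0 (t - a * of_int k))) \<partial>count_space (UNIV::int set)) \<le> ennreal (enn2real I / (a * m))"
    proof eventually_elim
      case (elim t)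
      have cell: "ennreal (a * m) * ennreal (cmod (g0 (t - a * of_int k)))
         \<le> (\<integral>\<^sup>+x. indicator {0..<a} (x - t + a * of_int k) * ennreal (F x) \<partial>lborel)" for k :: int
      proof -
        let ?z = "cmod (g0 (t - a * of_int k))"
        have "(\<integral>\<^sup>+x. indicator {0..<a} (x - t + a * of_int k) * ennreal (m * ?z) \<partial>lborel)
          = (\<integral>\<^sup>+x. indicator {0..<a} x * ennreal (m * ?z) \<partial>lborel)"
          using nn_integral_shift[of "\<lambda>x. indicator {0..<a} x * ennreal (m * ?z)" "a * of_int k - t"]
          by (simp add: algebra_simps)
        also have "\<dots> = ennreal a * ennreal (m * ?z)"
          using a by (simp add: nn_integral_multc)
        also have "\<dots> = ennreal (a * m) * ennreal ?z"
          using a m by (simp add: ennreal_mult mult.assoc)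
        finally have "ennreal (a * m) * ennreal ?z
          = (\<integral>\<^sup>+x. indicator {0..<a} (x - t + a * of_int k) * ennreal (m * ?z) \<partial>lborel)" ..
        also have "\<dots> \<le> (\<integral>\<^sup>+x. indicator {0..<a} (x - t + a * of_int k) * ennreal (F x) \<partial>lborel)"
        proof (rule nn_integral_mono_AE)
          have "AE x in lborel. ?z * cmod (h0 (t - a * of_int k - x)) \<le> F x"
            using elim by blast
          then show "AE x in lborel. indicator {0..<a} (x - t + a * of_int k) * ennreal (m * ?z)
              \<le> indicator {0..<a} (x - t + a * of_int k) * ennreal (F x)"
          proof eventually_elim
            case (elim x)
            show ?case
            proof (cases "x - t + a * of_int k \<in> {0..<a}")
              case True
              then have "m \<le> cmod (h0 (t - a * of_int k - x))"
                by (intro m_le) auto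
              then have "m * ?z \<le> F x"
                using elim mult_right_mono[of m "cmod (h0 (t - a * of_int k - x))" ?z] by (simp add: mult.commute)
              then show ?thesis
                by (intro mult_left_mono ennreal_leI) auto
            qed simp
          qed
        qed
        finally show ?thesis .
      qed
      have "ennreal (a * m) * (\<integral>\<^sup>+k. ennreal (cmod (g0 (t - a * of_int k))) \<partial>count_space (UNIV::int set))
         = (\<integral>\<^sup>+k. ennreal (a * m) * ennreal (cmod (g0 (t - a * of_int k))) \<partial>count_space (UNIV::int set))"
        by (simp add: nn_integral_cmult)
      also have "\<dots> \<le> (\<integral>\<^sup>+k. \<integral>\<^sup>+x. indicator {0..<a} (x - t + a * of_int k) * ennreal (F x) \<partial>lborel \<partial>count_space (UNIV::int set))"
        by (intro nn_integral_mono cell)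
      also have "\<dots> = (\<integral>\<^sup>+x. \<integral>\<^sup>+k. indicator {0..<a} (x - t + a * of_int k) * ennreal (F x) \<partial>count_space (UNIV::int set) \<partial>lborel)"
        by (rule nn_integral_count_space_nn_integral[symmetric]) auto
      also have "\<dots> = I"
        by (simp add: nn_integral_multc nn_integral_lattice_indicator[OF a] I_def)
      finally have le: "ennreal (a * m) * (\<integral>\<^sup>+k. ennreal (cmod (g0 (t - a * of_int k))) \<partial>count_space (UNIV::int set)) \<le> I" .
      have "(\<integral>\<^sup>+k. ennreal (cmod (g0 (t - a * of_int k))) \<partial>count_space (UNIV::int set))
         = ennreal (1 / (a * m)) * (ennreal (a * m) * (\<integral>\<^sup>+k. ennreal (cmod (g0 (t - a * of_int k))) \<partial>count_space (UNIV::int set)))"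
        using a m by (simp add: mult.assoc[symmetric] ennreal_mult[symmetric])
      also have "\<dots> \<le> ennreal (1 / (a * m)) * I"
        by (intro mult_left_mono le) simp
      also have "\<dots> = ennreal (1 / (a * m)) * ennreal (enn2real I)"
        using I by simp
      also have "\<dots> = ennreal (enn2real I / (a * m))"
        using a m by (simp add: ennreal_mult[symmetric])
      finally show ?case .
    qed
  qed
qed

lemma nn_integral_count_space_int_shift:
  fixes f :: "int \<Rightarrow> ennreal"
  shows "(\<integral>\<^sup>+k. f (j + k) \<partial>count_space UNIV) = (\<integral>\<^sup>+k. f k \<partial>count_space UNIV)"
  by (rule nn_integral_bij_count_space) (rule bij_betw_byWitness[where f'="\<lambda>k. k - j"], auto)

text \<open>The exceptional set of a lattice sum is invariant under the lattice. Setting the function to \<open>0\<close> there makes the bound hold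
at every point, and cutting off on a larger set does no harm because it only decreases the sums.\<close>

lemma wiener_bound_cutoff:
  fixes g0 :: "real \<Rightarrow> complex" and B :: "real set"
  assumes "\<And>t. (\<integral>\<^sup>+k. ennreal (cmod (g0 (t - a * of_int k))) \<partial>count_space (UNIV::int set)) > ennreal C \<Longrightarrow> t \<in> B"
  shows "wiener_bound a C (\<lambda>t. if t \<in> B then 0 else g0 t)"
  unfolding wiener_bound_def
proof
  fix t
  let ?G = "\<lambda>t. if t \<in> B then 0 else g0 t"
  let ?S = "\<lambda>t. \<integral>\<^sup>+k. ennreal (cmod (g0 (t - a * of_int k))) \<partial>count_space (UNIV::int set)"
  have inv: "?S (t - a * of_int j) = ?S t" for j :: int
    using nn_integral_count_space_int_shift[of "\<lambda>k. ennreal (cmod (g0 (t - a * of_int k)))" j]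
    by (simp add: algebra_simps)
  show "(\<integral>\<^sup>+k. ennreal (cmod (?G (t - a * of_int k))) \<partial>count_space (UNIV::int set)) \<le> ennreal C"
  proof (cases "?S t > ennreal C")
    case True
    then have "t - a * of_int k \<in> B" for k :: int
      by (intro assms) (simp only: inv)
    then show ?thesis by simp
  next
    case False
    have "(\<integral>\<^sup>+k. ennreal (cmod (?G (t - a * of_int k))) \<partial>count_space (UNIV::int set)) \<le> ?S t"
      by (intro nn_integral_mono) auto
    with False show ?thesis by (meson not_less order_trans)
  qed
qed

lemma wiener_bound_mono: "wiener_bound a C G \<Longrightarrow> C \<le> D \<Longrightarrow> wiener_bound a D G"
  unfolding wiener_bound_def by (meson ennreal_leI order_trans)

text \<open>Two lattices at once: translations by integers occur in the periodization, translations by multiples of \<open>1 / \<beta>\<close> in the Bessel inequality.\<close>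

lemma feichtinger_wiener_representative:
  assumes g: "g \<in> feichtinger_algebra" and "0 < a" "0 < b"
  obtains G C where "G \<in> borel_measurable borel" "AE t in lborel. g t = G t" "0 < C"
    "wiener_bound a C G" "wiener_bound b C G"
proof -
  have "g \<in> borel_measurable lebesgue"
    using g by (simp add: feichtinger_algebra_def L2_def)
  then obtain g0 where g0 [measurable]: "g0 \<in> borel_measurable borel" and eq: "AE t in lborel. g t = g0 t"
    by (rule borel_representative)
  let ?S = "\<lambda>a t. \<integral>\<^sup>+k. ennreal (cmod (g0 (t - a * of_int k))) \<partial>count_space (UNIV::int set)"
  obtain C1 where C1: "0 \<le> C1" "AE t in lborel. ?S a t \<le> ennreal C1"
    using feichtinger_AE_lattice_sum_bound[OF g \<open>0 < a\<close> g0 eq] .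
  obtain C2 where C2: "0 \<le> C2" "AE t in lborel. ?S b t \<le> ennreal C2"
    using feichtinger_AE_lattice_sum_bound[OF g \<open>0 < b\<close> g0 eq] .
  define B where "B = {t. ?S a t > ennreal C1} \<union> {t. ?S b t > ennreal C2}"
  define G where "G t = (if t \<in> B then 0 else g0 t)" for t
  show thesis
  proof
    have [measurable]: "B \<in> sets borel"
      unfolding B_def by measurable
    show "G \<in> borel_measurable borel"
      unfolding G_def by measurable
    show "AE t in lborel. g t = G t"
      using eq C1(2) C2(2) by eventually_elim (auto simp: G_def B_def)
    show "0 < C1 + C2 + 1" using C1(1) C2(1) by simp
    have "wiener_bound a C1 G" "wiener_bound b C2 G"
      unfolding G_def by (rule wiener_bound_cutoff, simp add: B_def)+
    then show "wiener_bound a (C1 + C2 + 1) G" "wiener_bound b (C1 + C2 + 1) G"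
      using C1(1) C2(1) by (auto elim!: wiener_bound_mono)
  qed
qed

section \<open>Quasi-periodic functions and their coefficients\<close>

lemma nn_integral_count_space_conv_infsum:
  fixes f :: "'a \<Rightarrow> real"
  assumes "f summable_on UNIV" "\<And>x. 0 \<le> f x"
  shows "(\<integral>\<^sup>+x. ennreal (f x) \<partial>count_space UNIV) = ennreal (infsum f UNIV)"
proof -
  have abs: "Infinite_Set_Sum.abs_summable_on f UNIV"
    using assms by (simp add: abs_summable_equivalent[symmetric])
  then have "(\<integral>\<^sup>+x. ennreal (f x) \<partial>count_space UNIV) = ennreal (infsetsum f UNIV)"
    using assms(2) unfolding infsetsum_def Infinite_Set_Sum.abs_summable_on_def
    by (intro nn_integral_eq_integral) auto
  then show ?thesis
    using infsetsum_infsum[OF abs] by simp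
qed

lemma infsum_int_shift:
  fixes f :: "int \<Rightarrow> complex"
  shows "(\<Sum>\<^sub>\<infinity>k. f (k - m)) = (\<Sum>\<^sub>\<infinity>k. f k)"
  by (rule infsum_reindex_bij_betw[where g="\<lambda>k. k - m"]) (rule bij_betw_byWitness[where f'="\<lambda>k. k + m"], auto)

lemma quasi_periodization_shift:
  "quasi_periodization \<nu> f (t + of_int m) = cis (2 * pi * of_int m * \<nu>) * quasi_periodization \<nu> f t"
proof -
  have "quasi_periodization \<nu> f (t + of_int m)
    = (\<Sum>\<^sub>\<infinity>k::int. cis (2 * pi * of_int m * \<nu>) * (cis (2 * pi * of_int (k - m) * \<nu>) * f (t - of_int (k - m))))"
    unfolding quasi_periodization_def
  proof (rule infsum_cong)
    fix k :: int
    have "cis (2 * pi * of_int k * \<nu>) = cis (2 * pi * of_int m * \<nu>) * cis (2 * pi * of_int (k - m) * \<nu>)"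
      by (simp add: cis_mult algebra_simps)
    moreover have "t + of_int m - of_int k = t - of_int (k - m)"
      by simp
    ultimately show "cis (2 * pi * of_int k * \<nu>) * f (t + of_int m - of_int k)
      = cis (2 * pi * of_int m * \<nu>) * (cis (2 * pi * of_int (k - m) * \<nu>) * f (t - of_int (k - m)))"
      by (simp only: mult.assoc)
  qed
  also have "\<dots> = (\<Sum>\<^sub>\<infinity>k::int. cis (2 * pi * of_int m * \<nu>) * (cis (2 * pi * of_int k * \<nu>) * f (t - of_int k)))"
    by (rule infsum_int_shift)
  also have "\<dots> = cis (2 * pi * of_int m * \<nu>) * quasi_periodization \<nu> f t"
    unfolding quasi_periodization_def by (rule infsum_cmult_right') 
  finally show ?thesis .
qed

lemma wiener_bound_norm_summable:
  assumes "wiener_bound a C G" "0 \<le> C"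
  shows "integrable (count_space (UNIV::int set)) (\<lambda>k. G (t - a * of_int k))"
    and "(LINT k|count_space (UNIV::int set). cmod (G (t - a * of_int k))) \<le> C"
proof -
  have le: "(\<integral>\<^sup>+k. ennreal (cmod (G (t - a * of_int k))) \<partial>count_space (UNIV::int set)) \<le> ennreal C"
    using assms(1) by (simp add: wiener_bound_def)
  then show int: "integrable (count_space (UNIV::int set)) (\<lambda>k. G (t - a * of_int k))"
    by (auto simp: integrable_iff_bounded intro: le_less_trans)
  show "(LINT k|count_space (UNIV::int set). cmod (G (t - a * of_int k))) \<le> C"
    using le assms(2) nn_integral_eq_integral[OF integrable_norm[OF int]] by simp
qed

text \<open>For a window with bounded lattice sums the periodizing series converges absolutely at every point, so the default value of the
infinite sum never occurs and the sum is an integral over the counting measure.\<close>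

lemma quasi_periodization_wiener:
  assumes G: "G \<in> borel_measurable borel" "wiener_bound 1 C G" "0 \<le> C"
  shows "quasi_periodization \<nu> G t
      = (LINT k|count_space (UNIV::int set). cis (2 * pi * of_int k * \<nu>) * G (t - of_int k))"
    and "cmod (quasi_periodization \<nu> G t) \<le> C"
    and "quasi_periodization \<nu> G \<in> borel_measurable borel"
proof -
  have norm: "cmod (cis (2 * pi * of_int k * \<nu>) * G (t - of_int k)) = cmod (G (t - 1 * of_int k))" for t and k :: int
    by (simp add: norm_mult)
  have int: "integrable (count_space (UNIV::int set)) (\<lambda>k. cis (2 * pi * of_int k * \<nu>) * G (t - of_int k))" for t
    using wiener_bound_norm_summable(1)[OF G(2,3), of t]
    by (rule Bochner_Integration.integrable_bound) (auto simp: norm_mult)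
  have eq: "quasi_periodization \<nu> G t
      = (LINT k|count_space (UNIV::int set). cis (2 * pi * of_int k * \<nu>) * G (t - of_int k))" for t
    unfolding quasi_periodization_def
    by (subst infsetsum_infsum[symmetric]) (use int[of t] in \<open>auto simp: Infinite_Set_Sum.abs_summable_on_def infsetsum_def\<close>)
  then show "quasi_periodization \<nu> G t
      = (LINT k|count_space (UNIV::int set). cis (2 * pi * of_int k * \<nu>) * G (t - of_int k))" .
  have "cmod (quasi_periodization \<nu> G t) \<le> (LINT k|count_space (UNIV::int set). cmod (G (t - 1 * of_int k)))"
    unfolding eq norm[symmetric] by (rule integral_norm_bound)
  also have "\<dots> \<le> C"
    using wiener_bound_norm_summable(2)[OF G(2,3)] .
  finally show "cmod (quasi_periodization \<nu> G t) \<le> C" .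
  interpret Z: sigma_finite_measure "count_space (UNIV::int set)"
    by (simp add: sigma_finite_measure_count_space_countable)
  have [measurable]: "G \<in> borel_measurable borel" by fact
  show "quasi_periodization \<nu> G \<in> borel_measurable borel"
    unfolding eq[abs_def] by (rule Z.borel_measurable_lebesgue_integral) measurable
qed

lemma wiener_bound_modulation: "wiener_bound a C G \<Longrightarrow> wiener_bound a C (modulation \<xi> G)"
  by (simp add: wiener_bound_def)

lemma quasi_periodization_cong_AE:
  assumes "AE t in lborel. f t = g t"
  shows "AE t in lborel. quasi_periodization \<nu> f t = quasi_periodization \<nu> g t"
proof -
  have "AE t in lborel. \<forall>k::int. f (t - of_int k) = g (t - of_int k)"
    unfolding AE_all_countable using AE_lborel_shift[OF assms, of "- of_int k" for k :: int] by simp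
  then show ?thesis
    by eventually_elim (simp add: quasi_periodization_def)
qed

lemma quasi_periodization_in_L2_quasi:
  assumes G: "G \<in> borel_measurable borel" "wiener_bound 1 C G" "0 \<le> C"
    and eq: "AE t in lborel. g t = G t"
  shows "quasi_periodization \<nu> g \<in> L2_quasi \<nu>"
proof -
  let ?p = "quasi_periodization \<nu> g" and ?q = "quasi_periodization \<nu> G"
  note q = quasi_periodization_wiener[OF G, of \<nu>]
  have [measurable]: "?q \<in> borel_measurable borel" by (rule q(3))
  have AE: "AE t in lborel. ?p t = ?q t"
    using eq by (rule quasi_periodization_cong_AE)
  have "?p \<in> borel_measurable lebesgue"
  proof (rule borel_measurable_AE)
    show "?q \<in> borel_measurable lebesgue"
      by (rule measurable_completion) simp
    show "AE t in lebesgue. ?q t = ?p t"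
      using AE_completion[OF AE] by eventually_elim simp
  qed
  moreover have "set_integrable lebesgue {0<..<1} (\<lambda>t. (cmod (?p t))\<^sup>2)"
    unfolding set_integrable_def
  proof (subst lebesgue_integral_eq_lborel(2))
    show "AE t in lborel. indicator {0<..<1} t *\<^sub>R (cmod (?p t))\<^sup>2 = indicator {0<..<1} t *\<^sub>R (cmod (?q t))\<^sup>2"
      using AE by eventually_elim simp
    show "integrable lborel (\<lambda>t. indicator {0<..<1} t *\<^sub>R (cmod (?q t))\<^sup>2)"
    proof (rule Bochner_Integration.integrable_bound)
      show "integrable lborel (\<lambda>t. indicator {0<..<1::real} t * C\<^sup>2)"
        by (intro integrable_mult_left integrable_real_indicator) auto
      show "AE t in lborel. norm (indicator {0<..<1} t *\<^sub>R (cmod (?q t))\<^sup>2) \<le> norm (indicator {0<..<1} t * C\<^sup>2)"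
        using power_mono[OF q(2) norm_ge_zero, of _ 2] by (auto simp: indicator_def)
    qed measurable
  qed measurable
  ultimately show ?thesis
    by (simp add: L2_quasi_def quasi_periodization_shift)
qed

text \<open>Quasi-periodicity moves the phase factors of the periodization onto \<open>f\<close>, which turns the integrand into the periodization
of \<open>f0 cnj (G)\<close>; the integral over the unit interval then unfolds to the line.\<close>

lemma quasi_inner_eq_line_integral:
  assumes G [measurable]: "G \<in> borel_measurable borel" and W: "wiener_bound 1 C G" "0 \<le> C"
    and eq: "AE t in lborel. g t = G t"
    and f0 [measurable]: "f0 \<in> borel_measurable borel" and f: "AE t in lborel. f t = f0 t"
    and per: "\<And>k::int. AE t in lborel. f0 (t + of_int k) = cis (2 * pi * of_int k * \<nu>) * f0 t"
    and int: "integrable lborel (\<lambda>t. f0 t * cnj (G t))"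
  shows "L2_unit_inner f (quasi_periodization \<nu> g) = (LINT t|lborel. f0 t * cnj (G t))"
proof -
  let ?p = "quasi_periodization \<nu> g" and ?q = "quasi_periodization \<nu> G"
  note q = quasi_periodization_wiener[OF G W, of \<nu>]
  have [measurable]: "?q \<in> borel_measurable borel" by (rule q(3))
  have per': "AE t in lborel. \<forall>k::int. f0 (t + of_int k) = cis (2 * pi * of_int k * \<nu>) * f0 t"
    using per by (simp add: AE_all_countable)
  have "L2_unit_inner f ?p = (LINT t:{0<..<1}|lborel. f0 t * cnj (?q t))"
    unfolding L2_unit_inner_def set_lebesgue_integral_def
  proof (rule lebesgue_integral_eq_lborel(1))
    show "AE t in lborel. indicator {0<..<1} t *\<^sub>R (f t * cnj (?p t)) = indicator {0<..<1} t *\<^sub>R (f0 t * cnj (?q t))"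
      using f quasi_periodization_cong_AE[OF eq, of \<nu>] by eventually_elim simp
  qed measurable
  also have "\<dots> = (LINT t:{0<..<1}|lborel. LINT k|count_space (UNIV::int set). f0 (t - of_int k) * cnj (G (t - of_int k)))"
    unfolding set_lebesgue_integral_def
  proof (rule integral_cong_AE)
    interpret Z: sigma_finite_measure "count_space (UNIV::int set)"
      by (simp add: sigma_finite_measure_count_space_countable)
    have "(\<lambda>t. LINT k|count_space (UNIV::int set). f0 (t - of_int k) * cnj (G (t - of_int k))) \<in> borel_measurable lborel"
      by (rule Z.borel_measurable_lebesgue_integral) measurable
    then show "(\<lambda>t. indicator {0<..<1} t *\<^sub>R (LINT k|count_space (UNIV::int set). f0 (t - of_int k) * cnj (G (t - of_int k)))) \<in> borel_measurable lborel"
      by measurable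
    show "AE t in lborel. indicator {0<..<1} t *\<^sub>R (f0 t * cnj (?q t))
      = indicator {0<..<1} t *\<^sub>R (LINT k|count_space (UNIV::int set). f0 (t - of_int k) * cnj (G (t - of_int k)))"
      using per'
    proof eventually_elim
      case (elim t)
      have "f0 (t - of_int k) = f0 t * cnj (cis (2 * pi * of_int k * \<nu>))" for k :: int
        using elim[rule_format, of "- k"] by (simp add: cis_cnj mult.commute)
      then have "(LINT k|count_space (UNIV::int set). f0 (t - of_int k) * cnj (G (t - of_int k)))
          = (LINT k|count_space (UNIV::int set). f0 t * cnj (cis (2 * pi * of_int k * \<nu>) * G (t - of_int k)))"
        by (simp add: mult.assoc)
      also have "\<dots> = f0 t * cnj (?q t)"
        unfolding q(1) integral_mult_right_zero Bochner_Integration.integral_cnj ..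
      finally show ?case by simp
    qed
  qed measurable
  also have "\<dots> = (LINT t|lborel. f0 t * cnj (G t))"
    by (rule integral_periodize[OF int])
  finally show ?thesis .
qed

lemma L2_quasi_representative:
  assumes f: "f \<in> L2_quasi \<nu>"
  obtains f0 D where "f0 \<in> borel_measurable borel" "AE t in lborel. f t = f0 t"
    "\<forall>k::int. AE t in lborel. f0 (t + of_int k) = cis (2 * pi * of_int k * \<nu>) * f0 t"
    "(\<integral>\<^sup>+t. indicator {0..<1} t * ennreal ((cmod (f0 t))\<^sup>2) \<partial>lborel) = ennreal D"
    "D = Re (L2_unit_inner f f)" "0 \<le> D"
proof -
  have "f \<in> borel_measurable lebesgue"
    using f by (simp add: L2_quasi_def)
  then obtain f0 where f0 [measurable]: "f0 \<in> borel_measurable borel" and eq: "AE t in lborel. f t = f0 t"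
    by (rule borel_representative)
  have per: "AE t in lborel. f0 (t + of_int k) = cis (2 * pi * of_int k * \<nu>) * f0 t" for k :: int
    using eq AE_lborel_shift[OF eq, of "of_int k"]
  proof eventually_elim
    case (elim t)
    have "f (t + of_int k) = cis (2 * pi * of_int k * \<nu>) * f t"
      using f by (simp add: L2_quasi_def)
    with elim show ?case by simp
  qed
  have int: "integrable lborel (\<lambda>t. indicator {0<..<1} t *\<^sub>R (cmod (f0 t))\<^sup>2)"
  proof -
    have "integrable lebesgue (\<lambda>t. indicator {0<..<1} t *\<^sub>R (cmod (f t))\<^sup>2)"
      using f by (simp add: L2_quasi_def set_integrable_def)
    then show ?thesis
    proof (subst (asm) lebesgue_integral_eq_lborel(2))
      show "AE t in lborel. indicator {0<..<1} t *\<^sub>R (cmod (f t))\<^sup>2 = indicator {0<..<1} t *\<^sub>R (cmod (f0 t))\<^sup>2"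
        using eq by eventually_elim simp
    qed auto
  qed
  define D where "D = (LINT t|lborel. indicator {0<..<1} t *\<^sub>R (cmod (f0 t))\<^sup>2)"
  have "L2_unit_inner f f = (LINT t|lborel. complex_of_real (indicator {0<..<1} t *\<^sub>R (cmod (f0 t))\<^sup>2))"
    unfolding L2_unit_inner_def set_lebesgue_integral_def
  proof (rule lebesgue_integral_eq_lborel(1))
    show "AE t in lborel. indicator {0<..<1} t *\<^sub>R (f t * cnj (f t)) = complex_of_real (indicator {0<..<1} t *\<^sub>R (cmod (f0 t))\<^sup>2)"
      using eq by eventually_elim (simp add: complex_norm_square scaleR_conv_of_real del: of_real_power)
  qed measurable
  then have inner: "L2_unit_inner f f = complex_of_real D"
    unfolding integral_complex_of_real D_def .
  have "AE t in lborel. t \<noteq> (0::real)" by (rule AE_lborel_singleton)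
  then have "(\<integral>\<^sup>+t. indicator {0..<1} t * ennreal ((cmod (f0 t))\<^sup>2) \<partial>lborel)
     = (\<integral>\<^sup>+t. ennreal (indicator {0<..<1} t *\<^sub>R (cmod (f0 t))\<^sup>2) \<partial>lborel)"
    by (intro nn_integral_cong_AE) (auto elim!: eventually_mono simp: indicator_def)
  also have "\<dots> = ennreal D"
    unfolding D_def by (rule nn_integral_eq_integral[OF int]) auto
  finally have nn: "(\<integral>\<^sup>+t. indicator {0..<1} t * ennreal ((cmod (f0 t))\<^sup>2) \<partial>lborel) = ennreal D" .
  have "0 \<le> D" unfolding D_def by (intro Bochner_Integration.integral_nonneg) auto
  show thesis
    by (rule that[OF f0 eq _ nn]) (use per inner \<open>0 \<le> D\<close> in auto)
qed

text \<open>The bound for finite sets of frequencies is uniform, so it passes to the full series.\<close>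

lemma wiener_bessel_infinite:
  fixes h G :: "real \<Rightarrow> complex" and \<beta> :: real
  assumes "0 < \<beta>" "G \<in> borel_measurable borel" "h \<in> borel_measurable borel"
    and "wiener_bound (1 / \<beta>) C G" "0 < C"
    and hG: "integrable lborel (\<lambda>t. (cmod (h t))\<^sup>2 * cmod (G t))"
  shows "(\<lambda>n::int. (cmod (LINT t|lborel. h t * cnj (modulation (\<beta> * of_int n) G t)))\<^sup>2) summable_on UNIV"
    and "(\<Sum>\<^sub>\<infinity>n::int. (cmod (LINT t|lborel. h t * cnj (modulation (\<beta> * of_int n) G t)))\<^sup>2)
      \<le> C / \<beta> * (LINT t|lborel. (cmod (h t))\<^sup>2 * cmod (G t))"
proof -
  note bessel = wiener_bessel[OF assms]
  show summable: "(\<lambda>n::int. (cmod (LINT t|lborel. h t * cnj (modulation (\<beta> * of_int n) G t)))\<^sup>2) summable_on UNIV"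
    by (rule nonneg_bdd_above_summable_on) (use bessel in \<open>auto intro!: bdd_aboveI2\<close>)
  show "(\<Sum>\<^sub>\<infinity>n::int. (cmod (LINT t|lborel. h t * cnj (modulation (\<beta> * of_int n) G t)))\<^sup>2)
      \<le> C / \<beta> * (LINT t|lborel. (cmod (h t))\<^sup>2 * cmod (G t))"
    by (rule infsum_le_finite_sums[OF summable]) (use bessel in auto)
qed

section \<open>The lower bound by truncation\<close>

text \<open>The integers \<open>k\<close> for which exactly one of \<open>k\<close> and \<open>t + k\<close> lies in \<open>[0, R)\<close> form the symmetric difference of an integer interval of
length \<open>R\<close> and its translate by \<open>-\<lfloor>t\<rfloor>\<close>. The bound \<open>2 R\<close> serves as a dominating function, the bound \<open>2 |\<lfloor>t\<rfloor>|\<close>,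
which does not depend on \<open>R\<close>, gives the convergence.\<close>

lemma cutoff_defect_count:
  fixes R :: nat and t :: real
  defines "w \<equiv> \<lambda>x::real. indicator {0..<real R} x :: real"
  shows "(\<integral>\<^sup>+k. ennreal ((w (t + of_int k) - w (of_int k))\<^sup>2) \<partial>count_space (UNIV::int set))
      \<le> ennreal (min (2 * real R) (2 * \<bar>of_int \<lfloor>t\<rfloor>\<bar>))"
proof -
  define m where "m = \<lfloor>t\<rfloor>"
  define S where "S = {k::int. (k \<in> {- m..<int R - m}) \<noteq> (k \<in> {0..<int R})}"
  have shifted: "t + of_int k \<in> {0..<real R} \<longleftrightarrow> k \<in> {- m..<int R - m}" for k :: int
  proof -
    have "0 \<le> t + of_int k \<longleftrightarrow> - k \<le> m"
      unfolding m_def le_floor_iff by auto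
    moreover have "t + of_int k < real R \<longleftrightarrow> m < int R - k"
      unfolding m_def floor_less_iff by auto
    ultimately show ?thesis by auto
  qed
  have "ennreal ((w (t + of_int k) - w (of_int k))\<^sup>2) = indicator S k" for k :: int
    using shifted[of k] by (auto simp: w_def S_def indicator_def)
  moreover have finS: "finite S"
    by (rule finite_subset[of _ "{- m..<int R - m} \<union> {0..<int R}"]) (auto simp: S_def)
  ultimately have "(\<integral>\<^sup>+k. ennreal ((w (t + of_int k) - w (of_int k))\<^sup>2) \<partial>count_space (UNIV::int set)) = ennreal (card S)"
    by (simp add: emeasure_count_space_finite ennreal_of_nat_eq_real_of_nat)
  also have "card S \<le> 2 * R"
  proof -
    have "card S \<le> card ({- m..<int R - m} \<union> {0..<int R})"
      by (rule card_mono) (auto simp: S_def)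
    also have "\<dots> \<le> card {- m..<int R - m} + card {0..<int R}"
      by (rule card_Un_le)
    finally show ?thesis by simp
  qed
  moreover have "card S \<le> nat (2 * \<bar>m\<bar>)"
  proof -
    have "card S \<le> card ({min 0 (- m)..<max 0 (- m)} \<union> {min (int R) (int R - m)..<max (int R) (int R - m)})"
      by (rule card_mono) (auto simp: S_def)
    also have "\<dots> \<le> card {min 0 (- m)..<max 0 (- m)} + card {min (int R) (int R - m)..<max (int R) (int R - m)}"
      by (rule card_Un_le)
    also have "\<dots> = nat (2 * \<bar>m\<bar>)"
      by auto
    finally show ?thesis .
  qed
  ultimately have "real (card S) \<le> min (2 * real R) (2 * \<bar>of_int m\<bar>)"
    by linarith
  then show ?thesis
    using \<open>(\<integral>\<^sup>+k. ennreal ((w (t + of_int k) - w (of_int k))\<^sup>2) \<partial>count_space (UNIV::int set)) = ennreal (card S)\<close>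
    by (simp add: m_def ennreal_leI)
qed

text \<open>As \<open>R\<close> is an integer, every point of the unit interval has exactly \<open>R\<close> integer translates in \<open>[0, R)\<close>.\<close>

lemma quasi_periodic_truncation_energy:
  assumes [measurable]: "f0 \<in> borel_measurable borel"
    and per: "\<And>k::int. AE t in lborel. cmod (f0 (t - of_int k)) = cmod (f0 t)"
    and D: "(\<integral>\<^sup>+t. indicator {0..<1} t * ennreal ((cmod (f0 t))\<^sup>2) \<partial>lborel) = ennreal D"
  shows "(\<integral>\<^sup>+t. ennreal ((cmod (f0 t))\<^sup>2) * indicator {0..<real R} t \<partial>lborel) = ennreal (real R) * ennreal D"
proof -
  have count: "(\<integral>\<^sup>+k. indicator {0..<real R} (t - 1 * of_int k) \<partial>count_space (UNIV::int set)) = ennreal (real R)"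
    if "t \<in> {0..<1}" for t :: real
  proof -
    \<comment> \<open>the factor \<open>1\<close> keeps the shape of lattice sums with step \<open>a = 1\<close>\<close>
    have "t - 1 * of_int k \<in> {0..<real R} \<longleftrightarrow> k \<in> {1 - int R..0}" for k :: int
      using that by auto
    then have "indicator {0..<real R} (t - 1 * of_int k) = (indicator {1 - int R..0} k :: ennreal)" for k :: int
      by (simp add: indicator_def)
    then show ?thesis
      by (simp add: emeasure_count_space_finite ennreal_of_nat_eq_real_of_nat)
  qed
  have "(\<integral>\<^sup>+t. ennreal ((cmod (f0 t))\<^sup>2) * indicator {0..<real R} t \<partial>lborel)
    = (\<integral>\<^sup>+t. indicator {0..<1} t * ennreal ((cmod (f0 t))\<^sup>2)
        * (\<integral>\<^sup>+k. indicator {0..<real R} (t - 1 * of_int k) \<partial>count_space (UNIV::int set)) \<partial>lborel)"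
  proof (rule nn_integral_periodic_mult)
    show "AE t in lborel. ennreal ((cmod (f0 (t - 1 * of_int k)))\<^sup>2) = ennreal ((cmod (f0 t))\<^sup>2)" for k :: int
      using per[of k] by eventually_elim simp
  qed auto
  also have "\<dots> = (\<integral>\<^sup>+t. indicator {0..<1} t * ennreal ((cmod (f0 t))\<^sup>2) * ennreal (real R) \<partial>lborel)"
    by (intro nn_integral_cong) (metis count indicator_simps(2) mult_zero_left)
  also have "\<dots> = ennreal (real R) * ennreal D"
    by (subst nn_integral_multc) (auto simp: D mult.commute)
  finally show ?thesis .
qed

lemma norm_add_square_le: "(cmod (x + y))\<^sup>2 \<le> 2 * (cmod x)\<^sup>2 + 2 * (cmod y)\<^sup>2"
proof -
  have "(cmod (x + y))\<^sup>2 \<le> (cmod x + cmod y)\<^sup>2"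
    by (intro power_mono norm_triangle_ineq) simp
  also have "\<dots> \<le> 2 * (cmod x)\<^sup>2 + 2 * (cmod y)\<^sup>2"
    using zero_le_power2[of "cmod x - cmod y"] by (simp add: power2_eq_square algebra_simps)
  finally show ?thesis .
qed

text \<open>The frame inequality on the line for \<open>h = w f0\<close> with \<open>w\<close> the indicator of \<open>[0, R)\<close>. For the coefficients with index \<open>k\<close>, write
\<open>w (t) = w (k) + (w (t) - w (k))\<close>. The constant part reproduces the coefficients \<open>c n\<close> up to phases, and \<open>w (k)\<close> is nonzero for exactly \<open>R\<close>
indices. The remainder is controlled by the Bessel inequality; after the substitution \<open>t \<mapsto> t + k\<close> the sum over \<open>k\<close> falls
on the squares of \<open>w (t + k) - w (k)\<close> alone, and these are counted by \<open>cutoff_defect_count\<close>.\<close>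

lemma truncated_frame_inequality:
  fixes f0 g G :: "real \<Rightarrow> complex" and \<beta> \<nu> :: real and R :: nat
  defines "c \<equiv> \<lambda>n::int. LINT t|lborel. f0 t * cnj (modulation (\<beta> * of_int n) G t)"
  assumes \<beta>: "0 < \<beta>"
    and lower: "\<forall>h\<in>L2. (\<lambda>i. (cmod (L2_inner h (gabor_system \<beta> g i)))\<^sup>2) summable_on UNIV \<and>
        A * Re (L2_inner h h) \<le> (\<Sum>\<^sub>\<infinity>i. (cmod (L2_inner h (gabor_system \<beta> g i)))\<^sup>2)"
    and G [measurable]: "G \<in> borel_measurable borel" and gG: "AE t in lborel. g t = G t"
    and W: "wiener_bound 1 C G" "wiener_bound (1 / \<beta>) C G" "0 < C"
    and f0 [measurable]: "f0 \<in> borel_measurable borel"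
    and per: "\<And>k::int. AE t in lborel. f0 (t + of_int k) = cis (2 * pi * of_int k * \<nu>) * f0 t"
    and D: "(\<integral>\<^sup>+t. indicator {0..<1} t * ennreal ((cmod (f0 t))\<^sup>2) \<partial>lborel) = ennreal D" "0 \<le> D"
    and int: "integrable lborel (\<lambda>t. (cmod (f0 t))\<^sup>2 * cmod (G t))"
  shows "ennreal (A * (real R * D))
    \<le> ennreal (real R) * ennreal (2 * (\<Sum>\<^sub>\<infinity>n. (cmod (c n))\<^sup>2))
      + ennreal (2 * (C / \<beta>)) * (\<integral>\<^sup>+t. ennreal (min (2 * real R) (2 * \<bar>of_int \<lfloor>t\<rfloor>\<bar>)) * ennreal ((cmod (f0 t))\<^sup>2 * cmod (G t)) \<partial>lborel)"
proof -
  define w :: "real \<Rightarrow> real" where "w = indicator {0..<real R}"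
  have [measurable]: "w \<in> borel_measurable borel" by (simp add: w_def)
  have w01: "w x = 0 \<or> w x = 1" for x by (simp add: w_def indicator_def)
  define h where "h t = complex_of_real (w t) * f0 t" for t
  define e where "e k t = complex_of_real (w t - w (of_int k)) * f0 t" for k :: int and t
  define G' where "G' k = translation (of_int k) G" for k :: int
  define Y where "Y k n = (LINT t|lborel. e k t * cnj (modulation (\<beta> * of_int n) (G' k) t))" for k n :: int
  have [measurable]: "h \<in> borel_measurable borel" "e k \<in> borel_measurable borel" "G' k \<in> borel_measurable borel" for k
    unfolding h_def e_def G'_def translation_def by measurable
  have G_int: "integrable lborel G"
    using wiener_bound_integrable[OF _ G W(1)] W(3) by simp
  have G'_W: "wiener_bound (1 / \<beta>) C (G' k)" for k
    unfolding G'_def by (rule wiener_bound_translation[OF W(2)])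
  have G'_int: "integrable lborel (G' k)" for k
    using integrable_shift[of G "- of_int k"] G_int by (simp add: G'_def translation_def[abs_def])
  have mod_per: "AE t in lborel. cmod (f0 (t + of_int k)) = cmod (f0 t)" for k :: int
    using per[of k] by eventually_elim (simp add: norm_mult)
  have mod_per': "AE t in lborel. cmod (f0 (t - of_int k)) = cmod (f0 t)" for k :: int
    using mod_per[of "- k"] by simp

  have f0G': "integrable lborel (\<lambda>t. (cmod (f0 t))\<^sup>2 * cmod (G' k t))" for k
  proof -
    have "AE t in lborel. (cmod (f0 t))\<^sup>2 * cmod (G t) = (cmod (f0 (t + of_int k)))\<^sup>2 * cmod (G t)"
      using mod_per[of k] by eventually_elim simp
    then have "integrable lborel (\<lambda>t. (cmod (f0 (t + of_int k)))\<^sup>2 * cmod (G t))"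
      using int by (subst integrable_cong_AE[symmetric]) auto
    then show ?thesis
      using integrable_shift[of "\<lambda>t. (cmod (f0 t))\<^sup>2 * cmod (G' k t)" "of_int k"]
      by (simp add: G'_def translation_def)
  qed
  have eG': "integrable lborel (\<lambda>t. (cmod (e k t))\<^sup>2 * cmod (G' k t))" for k
  proof (rule Bochner_Integration.integrable_bound[OF f0G'[of k]])
    have "cmod (e k t) \<le> cmod (f0 t)" for t
      using w01[of t] w01[of "of_int k"] by (auto simp: e_def norm_mult)
    then show "AE t in lborel. norm ((cmod (e k t))\<^sup>2 * cmod (G' k t)) \<le> norm ((cmod (f0 t))\<^sup>2 * cmod (G' k t))"
      by (auto intro!: mult_right_mono power_mono)
  qed measurable

  have energy: "(\<integral>\<^sup>+t. ennreal ((cmod (h t))\<^sup>2) \<partial>lborel) = ennreal (real R * D)"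
  proof -
    have "(\<integral>\<^sup>+t. ennreal ((cmod (h t))\<^sup>2) \<partial>lborel)
       = (\<integral>\<^sup>+t. ennreal ((cmod (f0 t))\<^sup>2) * indicator {0..<real R} t \<partial>lborel)"
      by (intro nn_integral_cong) (auto simp: h_def w_def norm_mult indicator_def)
    then show ?thesis
      using quasi_periodic_truncation_energy[OF f0 mod_per' D(1), of R] D(2) by (simp add: ennreal_mult)
  qed
  then have h_sq: "integrable lborel (\<lambda>t. (cmod (h t))\<^sup>2)"
    by (simp add: integrable_iff_bounded)
  have h_sq_int: "(LINT t|lborel. (cmod (h t))\<^sup>2) = real R * D"
    using energy nn_integral_eq_integral[OF h_sq] D(2) by simp
  have h_L2: "h \<in> L2"
    unfolding L2_def
  proof (intro CollectI conjI)
    show "h \<in> borel_measurable lebesgue"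
      by (rule measurable_completion) simp
    show "integrable lebesgue (\<lambda>t. (cmod (h t))\<^sup>2)"
      using h_sq by (subst integrable_completion) auto
  qed
  have "L2_inner h h = (LINT t|lborel. complex_of_real ((cmod (h t))\<^sup>2))"
    unfolding L2_inner_def complex_norm_square by (rule integral_completion) measurable
  then have h_norm: "Re (L2_inner h h) = real R * D"
    by (simp only: integral_complex_of_real h_sq_int Re_complex_of_real)

  have coeff: "L2_inner h (gabor_system \<beta> g (k, n))
     = (LINT t|lborel. h t * cnj (modulation (\<beta> * of_int n) (G' k) t))" for k n
    unfolding L2_inner_def
  proof (rule lebesgue_integral_eq_lborel(1))
    show "AE t in lborel. h t * cnj (gabor_system \<beta> g (k, n) t) = h t * cnj (modulation (\<beta> * of_int n) (G' k) t)"
      using AE_lborel_shift[OF gG, of "- of_int k"]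
      by eventually_elim (simp add: gabor_system_def modulation_def translation_def G'_def)
  qed measurable
  \<comment> \<open>moving the window by \<open>k\<close> only produces the unimodular factor \<open>?u\<close>, by quasi-periodicity of \<open>f0\<close>\<close>
  have c_shift: "cmod (LINT t|lborel. f0 t * cnj (modulation (\<beta> * of_int n) (G' k) t)) = cmod (c n)" for k n
  proof -
    let ?u = "cis (2 * pi * of_int k * \<nu>) * cnj (cis (2 * pi * (\<beta> * of_int n) * of_int k))"
    have "(LINT t|lborel. f0 t * cnj (modulation (\<beta> * of_int n) (G' k) t))
      = (LINT t|lborel. f0 (t + of_int k) * cnj (modulation (\<beta> * of_int n) (G' k) (t + of_int k)))"
      by (rule integral_shift[symmetric])
    also have "\<dots> = (LINT t|lborel. ?u * (f0 t * cnj (modulation (\<beta> * of_int n) G t)))"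
    proof (rule integral_cong_AE)
      have "cis (2 * pi * (\<beta> * of_int n) * (t + of_int k))
        = cis (2 * pi * (\<beta> * of_int n) * of_int k) * cis (2 * pi * (\<beta> * of_int n) * t)" for t
        by (simp add: cis_mult algebra_simps)
      then have M: "cnj (modulation (\<beta> * of_int n) (G' k) (t + of_int k))
        = cnj (cis (2 * pi * (\<beta> * of_int n) * of_int k)) * cnj (modulation (\<beta> * of_int n) G t)" for t
        by (simp only: modulation_def G'_def translation_def complex_cnj_mult mult.assoc add_diff_cancel_right')
      show "AE t in lborel. f0 (t + of_int k) * cnj (modulation (\<beta> * of_int n) (G' k) (t + of_int k))
         = ?u * (f0 t * cnj (modulation (\<beta> * of_int n) G t))"
        using per[of k] by eventually_elim (simp only: M mult_ac)
    qed measurable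
    also have "\<dots> = ?u * c n"
      unfolding c_def by (rule integral_mult_right_zero)
    finally show ?thesis
      by (simp add: norm_mult)
  qed
  have split: "(cmod (L2_inner h (gabor_system \<beta> g (k, n))))\<^sup>2
      \<le> 2 * (w (of_int k) * (cmod (c n))\<^sup>2) + 2 * (cmod (Y k n))\<^sup>2" for k n
  proof -
    let ?M = "modulation (\<beta> * of_int n) (G' k)"
    have "L2_inner h (gabor_system \<beta> g (k, n))
      = (LINT t|lborel. complex_of_real (w (of_int k)) * (f0 t * cnj (?M t)) + e k t * cnj (?M t))"
      unfolding coeff
    proof (rule Bochner_Integration.integral_cong[OF refl])
      fix t
      have "h t = complex_of_real (w (of_int k)) * f0 t + e k t"
        by (simp add: h_def e_def left_diff_distrib)
      then show "h t * cnj (?M t) = complex_of_real (w (of_int k)) * (f0 t * cnj (?M t)) + e k t * cnj (?M t)"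
        by (simp only: distrib_right mult.assoc)
    qed
    also have "\<dots> = complex_of_real (w (of_int k)) * (LINT t|lborel. f0 t * cnj (?M t)) + Y k n"
      unfolding Y_def using integrable_mult_cnj_modulation[OF _ G'_int f0G'] integrable_mult_cnj_modulation[OF _ G'_int eG']
      by (subst Bochner_Integration.integral_add) auto
    finally have "(cmod (L2_inner h (gabor_system \<beta> g (k, n))))\<^sup>2
      \<le> 2 * (cmod (complex_of_real (w (of_int k)) * (LINT t|lborel. f0 t * cnj (?M t))))\<^sup>2 + 2 * (cmod (Y k n))\<^sup>2"
      using norm_add_square_le by simp
    then show ?thesis
      using w01[of "of_int k"] by (auto simp: norm_mult c_shift)
  qed

  define s where "s = (\<Sum>\<^sub>\<infinity>n. (cmod (c n))\<^sup>2)"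
  have c_sum: "(\<integral>\<^sup>+n. ennreal ((cmod (c n))\<^sup>2) \<partial>count_space UNIV) = ennreal s"
    unfolding s_def c_def
    by (rule nn_integral_count_space_conv_infsum) (use wiener_bessel_infinite(1)[OF \<beta> G f0 W(2,3) int] in auto)
  have s_nn: "0 \<le> s" unfolding s_def by (rule infsum_nonneg) simp
  have Y_sum: "(\<integral>\<^sup>+n. ennreal ((cmod (Y k n))\<^sup>2) \<partial>count_space UNIV)
     \<le> ennreal (C / \<beta>) * (\<integral>\<^sup>+t. ennreal ((w (t + of_int k) - w (of_int k))\<^sup>2) * ennreal ((cmod (f0 t))\<^sup>2 * cmod (G t)) \<partial>lborel)" for k
  proof -
    have B: "(\<lambda>n. (cmod (Y k n))\<^sup>2) summable_on UNIV"
      "(\<Sum>\<^sub>\<infinity>n. (cmod (Y k n))\<^sup>2) \<le> C / \<beta> * (LINT t|lborel. (cmod (e k t))\<^sup>2 * cmod (G' k t))"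
      unfolding Y_def by (rule wiener_bessel_infinite[OF \<beta> _ _ G'_W W(3) eG']; simp)+
    have "(\<integral>\<^sup>+n. ennreal ((cmod (Y k n))\<^sup>2) \<partial>count_space UNIV) = ennreal (\<Sum>\<^sub>\<infinity>n. (cmod (Y k n))\<^sup>2)"
      by (rule nn_integral_count_space_conv_infsum[OF B(1)]) simp
    also have "\<dots> \<le> ennreal (C / \<beta> * (LINT t|lborel. (cmod (e k t))\<^sup>2 * cmod (G' k t)))"
      by (rule ennreal_leI[OF B(2)])
    also have "\<dots> = ennreal (C / \<beta>) * ennreal (LINT t|lborel. (cmod (e k t))\<^sup>2 * cmod (G' k t))"
      using \<beta> W(3) by (intro ennreal_mult Bochner_Integration.integral_nonneg) auto
    also have "ennreal (LINT t|lborel. (cmod (e k t))\<^sup>2 * cmod (G' k t)) = (\<integral>\<^sup>+t. ennreal ((cmod (e k t))\<^sup>2 * cmod (G' k t)) \<partial>lborel)"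
      by (rule nn_integral_eq_integral[OF eG', symmetric]) simp
    also have "\<dots> = (\<integral>\<^sup>+t. ennreal ((cmod (e k (t + of_int k)))\<^sup>2 * cmod (G' k (t + of_int k))) \<partial>lborel)"
      by (rule nn_integral_shift[symmetric]) measurable
    also have "\<dots> = (\<integral>\<^sup>+t. ennreal ((w (t + of_int k) - w (of_int k))\<^sup>2) * ennreal ((cmod (f0 t))\<^sup>2 * cmod (G t)) \<partial>lborel)"
    proof (rule nn_integral_cong_AE)
      show "AE t in lborel. ennreal ((cmod (e k (t + of_int k)))\<^sup>2 * cmod (G' k (t + of_int k)))
        = ennreal ((w (t + of_int k) - w (of_int k))\<^sup>2) * ennreal ((cmod (f0 t))\<^sup>2 * cmod (G t))"
        using mod_per[of k]
      proof eventually_elim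
        case (elim t)
        have "(cmod (e k (t + of_int k)))\<^sup>2 = (w (t + of_int k) - w (of_int k))\<^sup>2 * (cmod (f0 t))\<^sup>2"
          unfolding e_def norm_mult norm_of_real elim power_mult_distrib power2_abs ..
        then show ?case
          by (simp add: G'_def translation_def mult.assoc flip: ennreal_mult)
      qed
    qed
    finally show ?thesis .
  qed

  have "ennreal (A * (real R * D)) \<le> ennreal (\<Sum>\<^sub>\<infinity>i. (cmod (L2_inner h (gabor_system \<beta> g i)))\<^sup>2)"
    using bspec[OF lower h_L2] by (simp add: h_norm ennreal_leI)
  also have "\<dots> = (\<integral>\<^sup>+i. ennreal ((cmod (L2_inner h (gabor_system \<beta> g i)))\<^sup>2) \<partial>count_space UNIV)"
    using bspec[OF lower h_L2] by (intro nn_integral_count_space_conv_infsum[symmetric]) auto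
  also have "\<dots> = (\<integral>\<^sup>+k. \<integral>\<^sup>+n. ennreal ((cmod (L2_inner h (gabor_system \<beta> g (k, n))))\<^sup>2) \<partial>count_space UNIV \<partial>count_space UNIV)"
    by (rule nn_integral_fst_count_space[symmetric])
  also have "\<dots> \<le> (\<integral>\<^sup>+k. \<integral>\<^sup>+n. 2 * (ennreal (w (of_int k)) * ennreal ((cmod (c n))\<^sup>2)) + 2 * ennreal ((cmod (Y k n))\<^sup>2)
       \<partial>count_space UNIV \<partial>count_space UNIV)"
  proof (intro nn_integral_mono)
    fix k n :: int
    have "0 \<le> w (of_int k)" using w01[of "of_int k"] by auto
    then have "2 * (ennreal (w (of_int k)) * ennreal ((cmod (c n))\<^sup>2)) + 2 * ennreal ((cmod (Y k n))\<^sup>2)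
      = ennreal (2 * (w (of_int k) * (cmod (c n))\<^sup>2) + 2 * (cmod (Y k n))\<^sup>2)"
      by (simp add: ennreal_plus ennreal_mult)
    then show "ennreal ((cmod (L2_inner h (gabor_system \<beta> g (k, n))))\<^sup>2)
      \<le> 2 * (ennreal (w (of_int k)) * ennreal ((cmod (c n))\<^sup>2)) + 2 * ennreal ((cmod (Y k n))\<^sup>2)"
      using ennreal_leI[OF split[of k n]] by simp
  qed
  also have "\<dots> = (\<integral>\<^sup>+k. 2 * (ennreal (w (of_int k)) * ennreal s) + 2 * (\<integral>\<^sup>+n. ennreal ((cmod (Y k n))\<^sup>2) \<partial>count_space UNIV)
       \<partial>count_space (UNIV::int set))"
    by (intro nn_integral_cong) (simp add: nn_integral_add nn_integral_cmult c_sum)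
  also have "\<dots> \<le> (\<integral>\<^sup>+k. 2 * (ennreal (w (of_int k)) * ennreal s)
      + 2 * (ennreal (C / \<beta>) * (\<integral>\<^sup>+t. ennreal ((w (t + of_int k) - w (of_int k))\<^sup>2) * ennreal ((cmod (f0 t))\<^sup>2 * cmod (G t)) \<partial>lborel))
       \<partial>count_space (UNIV::int set))"
    by (intro nn_integral_mono add_left_mono mult_left_mono Y_sum) auto
  also have "\<dots> = 2 * ((\<integral>\<^sup>+k. ennreal (w (of_int k)) \<partial>count_space (UNIV::int set)) * ennreal s)
      + 2 * (ennreal (C / \<beta>) * (\<integral>\<^sup>+k. \<integral>\<^sup>+t. ennreal ((w (t + of_int k) - w (of_int k))\<^sup>2) * ennreal ((cmod (f0 t))\<^sup>2 * cmod (G t)) \<partial>lborel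
       \<partial>count_space (UNIV::int set)))"
    by (simp add: nn_integral_add nn_integral_cmult nn_integral_multc)
  also have "(\<integral>\<^sup>+k. ennreal (w (of_int k)) \<partial>count_space (UNIV::int set)) = ennreal (real R)"
  proof -
    have "ennreal (w (of_int k)) = indicator {0..<int R} k" for k :: int
      by (auto simp: w_def indicator_def)
    then show ?thesis
      by (simp add: emeasure_count_space_finite ennreal_of_nat_eq_real_of_nat)
  qed
  also have "(\<integral>\<^sup>+k. \<integral>\<^sup>+t. ennreal ((w (t + of_int k) - w (of_int k))\<^sup>2) * ennreal ((cmod (f0 t))\<^sup>2 * cmod (G t)) \<partial>lborel
       \<partial>count_space (UNIV::int set))
    = (\<integral>\<^sup>+t. \<integral>\<^sup>+k. ennreal ((w (t + of_int k) - w (of_int k))\<^sup>2) * ennreal ((cmod (f0 t))\<^sup>2 * cmod (G t)) \<partial>count_space (UNIV::int set)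
       \<partial>lborel)"
    by (rule nn_integral_count_space_nn_integral[symmetric]) auto
  also have "\<dots> = (\<integral>\<^sup>+t. (\<integral>\<^sup>+k. ennreal ((w (t + of_int k) - w (of_int k))\<^sup>2) \<partial>count_space (UNIV::int set)) * ennreal ((cmod (f0 t))\<^sup>2 * cmod (G t)) \<partial>lborel)"
    by (intro nn_integral_cong nn_integral_multc) simp
  also have "2 * (ennreal (real R) * ennreal s) + 2 * (ennreal (C / \<beta>) * \<dots>)
    \<le> 2 * (ennreal (real R) * ennreal s) + 2 * (ennreal (C / \<beta>) *
      (\<integral>\<^sup>+t. ennreal (min (2 * real R) (2 * \<bar>of_int \<lfloor>t\<rfloor>\<bar>)) * ennreal ((cmod (f0 t))\<^sup>2 * cmod (G t)) \<partial>lborel))"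
    unfolding w_def by (intro add_left_mono mult_left_mono nn_integral_mono mult_right_mono cutoff_defect_count) auto
  also have "\<dots> = ennreal (real R) * ennreal (2 * s)
      + ennreal (2 * (C / \<beta>)) * (\<integral>\<^sup>+t. ennreal (min (2 * real R) (2 * \<bar>of_int \<lfloor>t\<rfloor>\<bar>)) * ennreal ((cmod (f0 t))\<^sup>2 * cmod (G t)) \<partial>lborel)"
    using s_nn \<beta> W(3) by (simp only: ennreal_mult'[of 2, simplified]) (simp add: mult_ac)
  finally show ?thesis
    unfolding s_def .
qed

text \<open>Divide \<open>truncated_frame_inequality\<close> by \<open>R\<close>. The factor \<open>min (2 R) (2 |\<lfloor>t\<rfloor>|) / R\<close> is at most \<open>2\<close> and tends to \<open>0\<close> for each \<open>t\<close>, so by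
dominated convergence only the main term survives.\<close>

lemma quasi_lower_bound:
  fixes f0 g G :: "real \<Rightarrow> complex" and \<beta> \<nu> :: real
  defines "c \<equiv> \<lambda>n::int. LINT t|lborel. f0 t * cnj (modulation (\<beta> * of_int n) G t)"
  assumes \<beta>: "0 < \<beta>"
    and lower: "\<forall>h\<in>L2. (\<lambda>i. (cmod (L2_inner h (gabor_system \<beta> g i)))\<^sup>2) summable_on UNIV \<and>
        A * Re (L2_inner h h) \<le> (\<Sum>\<^sub>\<infinity>i. (cmod (L2_inner h (gabor_system \<beta> g i)))\<^sup>2)"
    and G [measurable]: "G \<in> borel_measurable borel" and gG: "AE t in lborel. g t = G t"
    and W: "wiener_bound 1 C G" "wiener_bound (1 / \<beta>) C G" "0 < C"
    and f0 [measurable]: "f0 \<in> borel_measurable borel"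
    and per: "\<And>k::int. AE t in lborel. f0 (t + of_int k) = cis (2 * pi * of_int k * \<nu>) * f0 t"
    and D: "(\<integral>\<^sup>+t. indicator {0..<1} t * ennreal ((cmod (f0 t))\<^sup>2) \<partial>lborel) = ennreal D" "0 \<le> D"
    and int: "integrable lborel (\<lambda>t. (cmod (f0 t))\<^sup>2 * cmod (G t))"
  shows "A * D \<le> 2 * (\<Sum>\<^sub>\<infinity>n. (cmod (c n))\<^sup>2)"
proof -
  define s where "s = (\<Sum>\<^sub>\<infinity>n. (cmod (c n))\<^sup>2)"
  have s_nn: "0 \<le> s" unfolding s_def by (rule infsum_nonneg) simp
  define \<phi> where "\<phi> t = (cmod (f0 t))\<^sup>2 * cmod (G t)" for t
  have \<phi>: "integrable lborel \<phi>" "\<And>t. 0 \<le> \<phi> t"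
    using int by (auto simp: \<phi>_def[abs_def])
  have [measurable]: "\<phi> \<in> borel_measurable borel" using \<phi>(1) by auto
  define q where "q R t = min (2 * real R) (2 * \<bar>of_int \<lfloor>t\<rfloor>\<bar>) / real R" for R :: nat and t :: real
  have [measurable]: "q R \<in> borel_measurable borel" for R
    unfolding q_def by measurable
  have q: "0 \<le> q R t" "q R t \<le> 2" for R t
    by (auto simp: q_def divide_simps)
  have int_q: "integrable lborel (\<lambda>t. q R t * \<phi> t)" for R
    using q \<phi>(2) by (intro Bochner_Integration.integrable_bound[OF integrable_mult_right[OF \<phi>(1), of 2]])
      (auto simp: abs_mult intro!: mult_right_mono)
  have bound: "A * D \<le> 2 * s + 2 * (C / \<beta>) * (LINT t|lborel. q (Suc n) t * \<phi> t)" for n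
  proof -
    let ?R = "real (Suc n)"
    let ?I = "LINT t|lborel. q (Suc n) t * \<phi> t"
    have I: "0 \<le> ?I" using q \<phi>(2) by (intro Bochner_Integration.integral_nonneg) auto
    have "(\<integral>\<^sup>+t. ennreal (min (2 * ?R) (2 * \<bar>of_int \<lfloor>t\<rfloor>\<bar>)) * ennreal (\<phi> t) \<partial>lborel)
      = (\<integral>\<^sup>+t. ennreal ?R * ennreal (q (Suc n) t * \<phi> t) \<partial>lborel)"
    proof (rule nn_integral_cong)
      fix t
      have "min (2 * ?R) (2 * \<bar>of_int \<lfloor>t\<rfloor>\<bar>) = ?R * q (Suc n) t"
        by (simp add: q_def del: of_nat_Suc)
      then show "ennreal (min (2 * ?R) (2 * \<bar>of_int \<lfloor>t\<rfloor>\<bar>)) * ennreal (\<phi> t) = ennreal ?R * ennreal (q (Suc n) t * \<phi> t)"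
        using q(1)[of "Suc n" t] \<phi>(2)[of t] by (simp add: ennreal_mult mult.assoc del: of_nat_Suc)
    qed
    also have "\<dots> = ennreal ?R * ennreal ?I"
      using q \<phi>(2) by (subst nn_integral_cmult) (auto simp: nn_integral_eq_integral[OF int_q])
    finally have nn: "(\<integral>\<^sup>+t. ennreal (min (2 * ?R) (2 * \<bar>of_int \<lfloor>t\<rfloor>\<bar>)) * ennreal (\<phi> t) \<partial>lborel) = ennreal ?R * ennreal ?I" .
    have "ennreal (A * (?R * D)) \<le> ennreal ?R * ennreal (2 * s) + ennreal (2 * (C / \<beta>)) * (ennreal ?R * ennreal ?I)"
      using truncated_frame_inequality[OF \<beta> lower G gG W f0 per D int, of "Suc n"]
      unfolding s_def c_def \<phi>_def[symmetric] nn .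
    also have "\<dots> = ennreal (?R * (2 * s) + 2 * (C / \<beta>) * (?R * ?I))"
    proof -
      have "0 \<le> ?R" "0 \<le> 2 * s" "0 \<le> 2 * (C / \<beta>)" "0 \<le> ?R * (2 * s)" "0 \<le> ?R * ?I" "0 \<le> 2 * (C / \<beta>) * (?R * ?I)"
        using s_nn I \<beta> W(3) by auto
      then show ?thesis
        using I by (simp only: ennreal_plus ennreal_mult)
    qed
    finally have "A * (?R * D) \<le> ?R * (2 * s) + 2 * (C / \<beta>) * (?R * ?I)"
      using s_nn I \<beta> W(3) by (subst (asm) ennreal_le_iff) (auto intro!: add_nonneg_nonneg mult_nonneg_nonneg)
    then have "?R * (A * D) \<le> ?R * (2 * s + 2 * (C / \<beta>) * ?I)"
      by (simp only: algebra_simps)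
    then show ?thesis
      by (rule mult_left_le_imp_le) simp
  qed
  have "(\<lambda>n. LINT t|lborel. q (Suc n) t * \<phi> t) \<longlonglongrightarrow> (LINT t|(lborel :: real measure). 0)"
  proof (rule integral_dominated_convergence[where w="\<lambda>t. 2 * \<phi> t"])
    have "(\<lambda>n. q (Suc n) t) \<longlonglongrightarrow> 0" for t
    proof (rule tendsto_sandwich[OF _ _ tendsto_const])
      show "(\<lambda>n. 2 * \<bar>of_int \<lfloor>t\<rfloor>\<bar> * inverse (real (Suc n))) \<longlonglongrightarrow> 0"
        by (rule tendsto_mult_right_zero[OF LIMSEQ_inverse_real_of_nat])
      show "\<forall>\<^sub>F n in sequentially. q (Suc n) t \<le> 2 * \<bar>of_int \<lfloor>t\<rfloor>\<bar> * inverse (real (Suc n))"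
        by (intro always_eventually allI) (auto simp: q_def divide_inverse intro!: mult_right_mono)
    qed (use q in auto)
    then show "AE t in lborel. (\<lambda>n. q (Suc n) t * \<phi> t) \<longlonglongrightarrow> 0"
      by (intro AE_I2 tendsto_mult_left_zero)
    show "AE t in lborel. norm (q (Suc n) t * \<phi> t) \<le> 2 * \<phi> t" for n
      using q \<phi>(2) by (auto simp: abs_mult intro!: mult_right_mono)
  qed (use \<phi> in auto)
  then have "(\<lambda>n. 2 * s + 2 * (C / \<beta>) * (LINT t|lborel. q (Suc n) t * \<phi> t)) \<longlonglongrightarrow> 2 * s + 2 * (C / \<beta>) * 0"
    by (intro tendsto_add tendsto_mult tendsto_const) simp
  then have "A * D \<le> 2 * s + 2 * (C / \<beta>) * 0"
    by (rule LIMSEQ_le_const) (use bound in auto)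
  then show ?thesis by (simp add: s_def)
qed

theorem corollary2:
  fixes \<nu> \<beta> :: real and g \<gamma> :: "real \<Rightarrow> complex"
  assumes "0 < \<beta>"
    and "g \<in> feichtinger_algebra"
    and "\<gamma> \<in> feichtinger_algebra"
    and "L2_norm g = 1"
    and "gabor_frame \<beta> g"
    and "is_dual_window \<beta> g \<gamma>"
  shows "quasi_gabor_frame \<nu> \<beta> g"
proof -
  note \<beta> = \<open>0 < \<beta>\<close>
  obtain G C where G: "G \<in> borel_measurable borel" and gG: "AE t in lborel. g t = G t"
    and C: "0 < C" and W: "wiener_bound 1 C G" "wiener_bound (1 / \<beta>) C G"
    using feichtinger_wiener_representative[OF assms(2), of 1 "1 / \<beta>"] \<beta> by auto
  obtain A where A: "0 < A"
    and lower: "\<forall>h\<in>L2. (\<lambda>i. (cmod (L2_inner h (gabor_system \<beta> g i)))\<^sup>2) summable_on UNIV \<and>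
        A * Re (L2_inner h h) \<le> (\<Sum>\<^sub>\<infinity>i. (cmod (L2_inner h (gabor_system \<beta> g i)))\<^sup>2)"
    using assms(5) unfolding gabor_frame_def is_frame_def by blast
  have mod_gG: "AE t in lborel. modulation \<xi> g t = modulation \<xi> G t" for \<xi>
    using gG by eventually_elim (simp add: modulation_def)
  note mod_W = wiener_bound_modulation[OF W(1)]
  have "quasi_gabor_system \<nu> \<beta> g n \<in> L2_quasi \<nu>" for n
    unfolding quasi_gabor_system_def
    by (rule quasi_periodization_in_L2_quasi[OF borel_measurable_modulation[OF G] mod_W _ mod_gG]) (use C in simp)
  moreover have "(\<lambda>n. (cmod (L2_unit_inner f (quasi_gabor_system \<nu> \<beta> g n)))\<^sup>2) summable_on UNIV \<and>
      A / 2 * Re (L2_unit_inner f f) \<le> (\<Sum>\<^sub>\<infinity>n. (cmod (L2_unit_inner f (quasi_gabor_system \<nu> \<beta> g n)))\<^sup>2) \<and>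
      (\<Sum>\<^sub>\<infinity>n. (cmod (L2_unit_inner f (quasi_gabor_system \<nu> \<beta> g n)))\<^sup>2) \<le> C / \<beta> * C * Re (L2_unit_inner f f)"
    if f: "f \<in> L2_quasi \<nu>" for f
  proof -
    obtain f0 D where f0: "f0 \<in> borel_measurable borel" and ff0: "AE t in lborel. f t = f0 t"
      and per_all: "\<forall>k::int. AE t in lborel. f0 (t + of_int k) = cis (2 * pi * of_int k * \<nu>) * f0 t"
      and D_int: "(\<integral>\<^sup>+t. indicator {0..<1} t * ennreal ((cmod (f0 t))\<^sup>2) \<partial>lborel) = ennreal D"
      and D_eq: "D = Re (L2_unit_inner f f)" and D_nn: "0 \<le> D"
      by (rule L2_quasi_representative[OF f])
    note D = D_int D_nn and per = per_all[rule_format]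
    have [measurable]: "f0 \<in> borel_measurable borel" "G \<in> borel_measurable borel" by fact+
    have sq_per: "AE t in lborel. (cmod (f0 (t - 1 * of_int k)))\<^sup>2 = (cmod (f0 t))\<^sup>2" for k :: int
      using per[of "- k"] by eventually_elim (simp add: norm_mult)
    have nn: "(\<integral>\<^sup>+t. ennreal ((cmod (f0 t))\<^sup>2 * cmod (G t)) \<partial>lborel) \<le> ennreal (C * D)"
      using nn_integral_periodic_mult_le[OF _ G _ W(1) _ sq_per] C D by (simp add: ennreal_mult)
    then have int: "integrable lborel (\<lambda>t. (cmod (f0 t))\<^sup>2 * cmod (G t))"
      by (auto simp: integrable_iff_bounded intro: le_less_trans)
    have int_le: "(LINT t|lborel. (cmod (f0 t))\<^sup>2 * cmod (G t)) \<le> C * D"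
      using nn nn_integral_eq_integral[OF int] C D(2) by simp
    have G_int: "integrable lborel G"
      using wiener_bound_integrable[OF _ G W(1)] C by simp
    have coeff: "L2_unit_inner f (quasi_gabor_system \<nu> \<beta> g n) = (LINT t|lborel. f0 t * cnj (modulation (\<beta> * of_int n) G t))" for n
      unfolding quasi_gabor_system_def
      by (rule quasi_inner_eq_line_integral[OF borel_measurable_modulation[OF G] mod_W _ mod_gG f0 ff0 per
            integrable_mult_cnj_modulation[OF f0 G_int int]]) (use C in simp)
    note bessel = wiener_bessel_infinite[OF \<beta> G f0 W(2) C int]
    have "(\<Sum>\<^sub>\<infinity>n::int. (cmod (LINT t|lborel. f0 t * cnj (modulation (\<beta> * of_int n) G t)))\<^sup>2) \<le> C / \<beta> * (C * D)"
      using bessel(2) mult_left_mono[OF int_le, of "C / \<beta>"] C \<beta> by simp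
    moreover have "A * D \<le> 2 * (\<Sum>\<^sub>\<infinity>n::int. (cmod (LINT t|lborel. f0 t * cnj (modulation (\<beta> * of_int n) G t)))\<^sup>2)"
      by (rule quasi_lower_bound[OF \<beta> lower G gG W C f0 per D int])
    ultimately show ?thesis
      using bessel(1) by (simp add: coeff D_eq[symmetric] mult.assoc)
  qed
  moreover have "0 < A / 2" "0 < C / \<beta> * C"
    using A C \<beta> by auto
  ultimately show ?thesis
    unfolding quasi_gabor_frame_def is_frame_def by blast
qed

end
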